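(* Let $C_1,C_2$ be real symmetric $3\times3$ matrices satisfying the standing assumptions (given in the context), and let $\lambda_1>\lambda_2>\lambda_3>0$ be the eigenvalues of $C_1^{-1}C_2$. Let $\boldsymbol\nu^1,\dots,\boldsymbol\nu^N$ be a finite sequence of parameters in $\mathbb R^2$, each $\boldsymbol\nu^j=(\nu^j_1,\nu^j_2)$ satisfying $\nu_2^j>0$ and $\nu_1^j+\lambda_3\nu_2^j>0$, and let $\mathcal C_{\boldsymbol\nu^1},\dots,\mathcal C_{\boldsymbol\nu^N}$ be the corresponding inner ellipses in the pencil. Then for all $k_1,\dots,k_N\in\mathbb Z$ the circle map on $\mathcal C_1$ $$P_*=(P_{\boldsymbol\nu^N})^{k_N}\circ(P_{\boldsymbol\nu^{N-1}})^{k_{N-1}}\circ\cdots\circ(P_{\boldsymbol\nu^1})^{k_1}$$ has the rotation number $$\rho(P_* )=k_1\rho(\boldsymbol\nu^1)+k_2\rho(\boldsymbol\nu^2)+\cdots+k_N\rho(\boldsymbol\nu^N),$$ where $\rho(\boldsymbol\nu)$ is given by $\rho(\boldsymbol\nu)=\frac{F(\omega(\boldsymbol\nu),e)}{2K(e)}$ with $\omega(\boldsymbol\nu)=\arcsin\sqrt{\frac{(\lambda_1-\lambda_3)\nu_2}{\lambda_1\nu_2+\nu_1}}$ and $e=\sqrt{\frac{\lambda_1-\lambda_2}{\lambda_1-\lambda_3}}$. In particular, if $\rho(P_* )\in\mathbb Z$ then $P_*=\mathrm{id}$. Similarly, if $P_*$ has a fixed point then $\rho(P_* )\in\mathbb Z$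 and hence $P_*=\mathrm{id}$.
   Context: A real symmetric $3\times3$ matrix $C$ defines the conic $\mathcal C=\{(x,y)\in\mathbb R^2:\mathbf u^TC\mathbf u=0,\ \mathbf u=(x,y,1)^T\}$. Standing assumptions on $(C_1,C_2)$: (i) for $i=1,2$ the upper-left $2\times2$ block of $C_i$ is positive definite and $\det C_i<0$; (ii) $C_1^{-1}C_2$ has three positive, distinct eigenvalues; (iii) whenever $\mathbf u\in\mathbb R^3$, $\mathbf u\ne0$ and $\mathbf u^TC_2\mathbf u=0$, then $\mathbf u^TC_1\mathbf u<0$ (the ellipse $\mathcal C_2$ is inside the ellipse $\mathcal C_1$). For $\boldsymbol\nu=(\nu_1,\nu_2)$ let $C_{\boldsymbol\nu}=\nu_1C_1+\nu_2C_2$, with conic $\mathcal C_{\boldsymbol\nu}$. If $\nu_2>0$ and $\nu_1+\lambda_3\nu_2>0$, then $\mathcal C_{\boldsymbol\nu}$ is an ellipse inside $\mathcal C_1$. Poncelet map: for such $\boldsymbol\nu$ and $z_0\in\mathcal C_1$, $P_{\boldsymbol\nu}(z_0)=z_1$ is the unique point of $\mathcal C_1$ such that the segment from $z_0$ to $z_1$ is tangent to $\mathcal C_{\boldsymbol\nu}$ with $\mathcal C_{\boldsymbol\nu}$ on the left when moving from $z_0$ to $z_1$; it is a homeomorphism of $\mathcal C_1$, and negative powers denote iterates of the inverse. Elliptic integrals: $F(\phi,e)=\int_0^\phi\frac{d\tau}{\sqrt{1-e^2\sin^2\tau}}$ and $K(e)=F(\pi/2,e)$. Rotation number: $\mathcal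 C_1$ is oriented counterclockwise and identified with $\mathbb R/\mathbb Z$ by an orientation-preserving homeomorphism; the rotation number of an orientation-preserving circle homeomorphism with lift $G:\mathbb R\to\mathbb R$ is $\lim_{n\to\infty}(G^n(x)-x)/n$, which is determined modulo integers by the circle map; the formula for $\rho(P_* )$ is understood in this sense, and $\rho(P_* )\in\mathbb Z$ means that $\sum_j k_j\rho(\boldsymbol\nu^j)\in\mathbb Z$. *)

theory Defs
  imports "HOL-Analysis.Analysis"
begin

definition hom_coord :: "real^2 \<Rightarrow> real^3" where
  "hom_coord z = vector [z$1, z$2, 1]"

definition conic_curve :: "real^3^3 \<Rightarrow> (real^2) set" where
  "conic_curve C = {z. hom_coord z \<bullet> (C *v hom_coord z) = 0}"

definition upper_left_block :: "real^3^3 \<Rightarrow> real^2^2" where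
  "upper_left_block C = vector [vector [C$1$1, C$1$2], vector [C$2$1, C$2$2]]"

definition pos_definite :: "real^'n^'n \<Rightarrow> bool" where
  "pos_definite A \<longleftrightarrow> transpose A = A \<and> (\<forall>x. x \<noteq> 0 \<longrightarrow> x \<bullet> (A *v x) > 0)"

definition eigenvalues :: "real^'n^'n \<Rightarrow> real set" where
  "eigenvalues A = {l. \<exists>v. v \<noteq> 0 \<and> A *v v = l *\<^sub>R v}"

definition pencil :: "real^3^3 \<Rightarrow> real^3^3 \<Rightarrow> real^2 \<Rightarrow> real^3^3" where
  "pencil C1 C2 \<nu> = \<nu>$1 *\<^sub>R C1 + \<nu>$2 *\<^sub>R C2"


text \<open>Twice the signed area of the triangle \<open>a\<close>, \<open>b\<close>, \<open>c\<close>: it is positive iff \<open>c\<close> lies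
  strictly to the left of the line directed from \<open>a\<close> to \<open>b\<close>.\<close>

definition orient :: "real^2 \<Rightarrow> real^2 \<Rightarrow> real^2 \<Rightarrow> real" where
  "orient a b c = (b$1 - a$1) * (c$2 - a$2) - (b$2 - a$2) * (c$1 - a$1)"

text \<open>For symmetric \<open>C\<close> and \<open>w\<close> on the conic, the left-hand side below is half the derivative at
  \<open>w\<close>, in the direction \<open>z - w\<close>, of the quadratic function defining the conic.\<close>

definition tangent_line :: "real^3^3 \<Rightarrow> real^2 \<Rightarrow> (real^2) set" where
  "tangent_line C w = {z. hom_coord z \<bullet> (C *v hom_coord w) = 0}"

definition segment_tangent :: "real^3^3 \<Rightarrow> real^2 \<Rightarrow> real^2 \<Rightarrow> bool" where
  "segment_tangent C z0 z1 \<longleftrightarrow> z0 \<noteq> z1 \<and>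
     (\<exists>w \<in> conic_curve C. w \<in> closed_segment z0 z1 \<and> z0 \<in> tangent_line C w \<and> z1 \<in> tangent_line C w)"

text \<open>The inequality is weak because the point of tangency lies on the directed line itself.\<close>

definition lies_left :: "(real^2) set \<Rightarrow> real^2 \<Rightarrow> real^2 \<Rightarrow> bool" where
  "lies_left S z0 z1 \<longleftrightarrow> (\<forall>w \<in> S. orient z0 z1 w \<ge> 0)"

definition poncelet :: "real^3^3 \<Rightarrow> real^3^3 \<Rightarrow> real^2 \<Rightarrow> real^2 \<Rightarrow> real^2" where
  "poncelet C1 C2 \<nu> z0 =
     (THE z1. z1 \<in> conic_curve C1 \<and> segment_tangent (pencil C1 C2 \<nu>) z0 z1 \<and>
              lies_left (conic_curve (pencil C1 C2 \<nu>)) z0 z1)"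

text \<open>Integer iterates of a bijection of \<open>S\<close>; only the values on \<open>S\<close> are meaningful.\<close>

definition int_iterate :: "'a set \<Rightarrow> ('a \<Rightarrow> 'a) \<Rightarrow> int \<Rightarrow> 'a \<Rightarrow> 'a" where
  "int_iterate S f k = (if k \<ge> 0 then f ^^ nat k else inv_into S f ^^ nat (- k))"

primrec poncelet_comp ::
  "real^3^3 \<Rightarrow> real^3^3 \<Rightarrow> (nat \<Rightarrow> real^2) \<Rightarrow> (nat \<Rightarrow> int) \<Rightarrow> nat \<Rightarrow> real^2 \<Rightarrow> real^2" where
  "poncelet_comp C1 C2 \<nu> k 0 = id"
| "poncelet_comp C1 C2 \<nu> k (Suc n) =
     int_iterate (conic_curve C1) (poncelet C1 C2 (\<nu> (Suc n))) (k (Suc n)) \<circ> poncelet_comp C1 C2 \<nu> k n"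


text \<open>A 1-periodic parametrization, i.e. an identification of \<open>\<real>/\<int>\<close> with the closed curve \<open>S\<close>.
  The orientation clause is the counterclockwise orientation of a strictly convex curve: three
  points met in this order within one turn form a positively oriented triangle.\<close>

definition ccw_param :: "(real^2) set \<Rightarrow> (real \<Rightarrow> real^2) \<Rightarrow> bool" where
  "ccw_param S p \<longleftrightarrow> continuous_on UNIV p \<and> (\<forall>t. p (t + 1) = p t) \<and>
     inj_on p {0..<1} \<and> range p = S \<and>
     (\<forall>a b c. a < b \<and> b < c \<and> c < a + 1 \<longrightarrow> orient (p a) (p b) (p c) > 0)"

text \<open>\<open>f\<close> has such a lift iff it acts as an orientation-preserving homeomorphism on the curve
  parametrized by \<open>p\<close>.\<close>

definition circle_lift :: "(real \<Rightarrow> 'a) \<Rightarrow> ('a \<Rightarrow> 'a) \<Rightarrow> (real \<Rightarrow> real) \<Rightarrow> bool" where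
  "circle_lift p f G \<longleftrightarrow> continuous_on UNIV G \<and> strict_mono G \<and>
     (\<forall>x. G (x + 1) = G x + 1) \<and> (\<forall>x. p (G x) = f (p x))"

text \<open>The rotation number is a class modulo integers: the integer \<open>m\<close> accounts for the choice of the
  lift. The two existence clauses make \<open>f\<close> an orientation-preserving homeomorphism of \<open>S\<close> and
  exclude vacuous truth.\<close>

definition has_rotation_number :: "(real^2) set \<Rightarrow> (real^2 \<Rightarrow> real^2) \<Rightarrow> real \<Rightarrow> bool" where
  "has_rotation_number S f r \<longleftrightarrow>
     (\<exists>p. ccw_param S p) \<and>
     (\<forall>p. ccw_param S p \<longrightarrow>
        (\<exists>G. circle_lift p f G) \<and>
        (\<forall>G. circle_lift p f G \<longrightarrow>
           (\<exists>m \<in> \<int>. \<forall>x. (\<lambda>n. ((G ^^ n) x - x) / real n) \<longlonglongrightarrow> r + m)))"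


definition elliptic_F :: "real \<Rightarrow> real \<Rightarrow> real" where
  "elliptic_F \<phi> e = (LBINT \<tau>=0..\<phi>. 1 / sqrt (1 - e\<^sup>2 * (sin \<tau>)\<^sup>2))"

definition elliptic_K :: "real \<Rightarrow> real" where
  "elliptic_K e = elliptic_F (pi / 2) e"

definition modulus :: "real \<Rightarrow> real \<Rightarrow> real \<Rightarrow> real" where
  "modulus l1 l2 l3 = sqrt ((l1 - l2) / (l1 - l3))"

definition omega :: "real \<Rightarrow> real \<Rightarrow> real^2 \<Rightarrow> real" where
  "omega l1 l3 \<nu> = arcsin (sqrt ((l1 - l3) * \<nu>$2 / (l1 * \<nu>$2 + \<nu>$1)))"

definition rho :: "real \<Rightarrow> real \<Rightarrow> real \<Rightarrow> real^2 \<Rightarrow> real" where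
  "rho l1 l2 l3 \<nu> =
     elliptic_F (omega l1 l3 \<nu>) (modulus l1 l2 l3) / (2 * elliptic_K (modulus l1 l2 l3))"

end

theory Submission
  imports Defs
begin

text \<open>Poncelet's porism has an explicit linearization: there is one parameter on the outer conic in which
the Poncelet maps of all inner conics of the pencil are translations. Translations commute, their
rotation numbers add, and a translation by \<open>r\<close> on \<open>\<real>/\<int>\<close> has a fixed point iff \<open>r\<close> is an
integer, in which case it is the identity. So everything follows from the linearization.

To find it, the two quadratic forms are diagonalized simultaneously
(\<open>simultaneous_normal_form\<close>). A projective map then takes the outer conic to the unit circle and the
member \<open>\<nu>\<close> of the pencil to the ellipse \<open>a x\<^sup>2 + b y\<^sup>2 = c\<close>, where \<open>a\<close>, \<open>b\<close>, \<open>c\<close> equal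
\<open>\<nu>\<^sub>1 + \<lambda> \<nu>\<^sub>2\<close> for \<open>\<lambda> = l1, l2, l3\<close>. It preserves tangency, and it can be chosen
to preserve orientation and not to send any point enclosed by the outer conic to infinity.

The chord from the angle \<open>\<sigma> - \<delta>\<close> to \<open>\<sigma> + \<delta>\<close> touches this ellipse, with the ellipse on the left, iff
\<open>cos\<^sup>2 \<delta> = (c / a) cos\<^sup>2 \<sigma> + (c / b) sin\<^sup>2 \<sigma>\<close> and \<open>cos \<delta> > 0\<close> (\<open>segment_tangent_pt\<close>,
\<open>lies_left_pt\<close>). By Euler's addition theorem (\<open>euler_addition\<close>) this relation holds along pairs of
solutions of \<open>\<theta>' = sqrt (1 - e\<^sup>2 sin\<^sup>2 \<theta>)\<close> with a constant time lag. The modulus \<open>e\<close> is the same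
for all \<open>\<nu>\<close>; only the lag, which is \<open>2 F(\<omega>, e)\<close>, depends on \<open>\<nu>\<close>. Hence the Poncelet map is the
time-\<open>2 F(\<omega>, e)\<close> map of this flow (\<open>poncelet_pt\<close>), and since a full turn takes time \<open>4 K(e)\<close>,
it is the translation by \<open>rho\<close> in the normalized time (\<open>poncelet_elliptic_param\<close>).

The rotation number is defined through an arbitrary counterclockwise parametrization and an
arbitrary lift; \<open>rotation_number_of_shift\<close> shows that all of them give \<open>r\<close> modulo integers.\<close>

section \<open>The amplitude function and Euler's addition theorem\<close>

definition Delta :: "real \<Rightarrow> real \<Rightarrow> real" where
  "Delta e x = sqrt (1 - e\<^sup>2 * (sin x)\<^sup>2)"

text \<open>Jacobi's amplitude: the angle reached after time \<open>t\<close> by the flow of the equation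
\<open>\<theta>' = Delta e \<theta>\<close> when it is started at \<open>0\<close>.\<close>

definition am :: "real \<Rightarrow> real \<Rightarrow> real" where
  "am e = inv (\<lambda>\<phi>. elliptic_F \<phi> e)"

context
  fixes e :: real
  assumes e: "e\<^sup>2 < 1"
begin

lemma Delta_radicand_pos: "0 < 1 - e\<^sup>2 * (sin x)\<^sup>2"
proof -
  have "e\<^sup>2 * (sin x)\<^sup>2 \<le> e\<^sup>2 * 1"
    by (intro mult_left_mono) (simp_all add: abs_square_le_1)
  with e show ?thesis by simp
qed

lemma Delta_pos: "0 < Delta e x"
  using Delta_radicand_pos[of x] by (simp add: Delta_def)

lemma Delta_square: "(Delta e x)\<^sup>2 = 1 - e\<^sup>2 * (sin x)\<^sup>2"
  using Delta_radicand_pos[of x] by (simp add: Delta_def)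

lemma Delta_le_1: "Delta e x \<le> 1"
  by (simp add: Delta_def)

lemma elliptic_F_deriv: "((\<lambda>\<phi>. elliptic_F \<phi> e) has_real_derivative 1 / Delta e \<phi>) (at \<phi>)"
proof -
  define b where "b = \<bar>\<phi>\<bar> + 1"
  have "continuous_on {-b..b} (\<lambda>\<tau>. 1 / sqrt (1 - e\<^sup>2 * (sin \<tau>)\<^sup>2))"
    using Delta_radicand_pos by (intro continuous_intros) (simp add: less_imp_neq[symmetric])
  then have "((\<lambda>u. LBINT y=0..u. 1 / sqrt (1 - e\<^sup>2 * (sin y)\<^sup>2)) has_vector_derivative
      1 / sqrt (1 - e\<^sup>2 * (sin \<phi>)\<^sup>2)) (at \<phi> within {-b..b})"
    using interval_integral_FTC2[of "-b" 0 b "\<lambda>\<tau>. 1 / sqrt (1 - e\<^sup>2 * (sin \<tau>)\<^sup>2)" \<phi>]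
    by (auto simp: b_def zero_ereal_def)
  moreover have "at \<phi> within {-b..b} = at \<phi>"
    by (rule at_within_Icc_at) (auto simp: b_def)
  ultimately show ?thesis
    by (simp add: has_real_derivative_iff_has_vector_derivative elliptic_F_def Delta_def)
qed

lemma elliptic_F_0: "elliptic_F 0 e = 0"
  by (simp add: elliptic_F_def flip: zero_ereal_def)

text \<open>The integrand is at least 1. This quantitative form of monotonicity also shows that
\<open>elliptic_F\<close> is unbounded in both directions, which gives its surjectivity.\<close>

lemma elliptic_F_expands:
  assumes "x \<le> y" shows "y - x \<le> elliptic_F y e - elliptic_F x e"
proof -
  have "elliptic_F x e - x \<le> elliptic_F y e - y"
  proof (rule DERIV_nonneg_imp_nondecreasing[OF assms])
    fix u
    have "((\<lambda>\<phi>. elliptic_F \<phi> e - \<phi>) has_real_derivative 1 / Delta e u - 1) (at u)"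
      by (auto intro!: derivative_eq_intros elliptic_F_deriv)
    moreover have "1 / Delta e u - 1 \<ge> 0"
      using Delta_pos[of u] Delta_le_1[of u] by simp
    ultimately show "\<exists>d. ((\<lambda>\<phi>. elliptic_F \<phi> e - \<phi>) has_real_derivative d) (at u) \<and> 0 \<le> d"
      by blast
  qed
  then show ?thesis by simp
qed

lemma elliptic_F_strict_mono: "strict_mono (\<lambda>\<phi>. elliptic_F \<phi> e)"
proof (rule strict_monoI)
  fix x y :: real assume "x < y"
  with elliptic_F_expands[of x y] show "elliptic_F x e < elliptic_F y e" by simp
qed

lemma elliptic_F_continuous: "continuous_on S (\<lambda>\<phi>. elliptic_F \<phi> e)"
  using elliptic_F_deriv by (meson DERIV_isCont continuous_at_imp_continuous_on)

lemma elliptic_F_bij: "bij (\<lambda>\<phi>. elliptic_F \<phi> e)"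
proof -
  have "\<exists>x. elliptic_F x e = y" for y
  proof -
    have "\<exists>x. - \<bar>y\<bar> \<le> x \<and> x \<le> \<bar>y\<bar> \<and> elliptic_F x e = y"
      using elliptic_F_expands[of "-\<bar>y\<bar>" 0] elliptic_F_expands[of 0 "\<bar>y\<bar>"]
      by (intro IVT') (auto simp: elliptic_F_0 elliptic_F_continuous)
    then show ?thesis by blast
  qed
  then show ?thesis
    using elliptic_F_strict_mono by (metis bij_def strict_mono_imp_inj_on surjI)
qed

lemma elliptic_F_am [simp]: "elliptic_F (am e t) e = t"
  unfolding am_def using surj_f_inv_f[OF bij_is_surj[OF elliptic_F_bij]] .

lemma am_elliptic_F [simp]: "am e (elliptic_F x e) = x"
  unfolding am_def using inv_f_f[OF bij_is_inj[OF elliptic_F_bij]] .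

lemma am_less_iff [simp]: "am e s < am e t \<longleftrightarrow> s < t"
  using strict_mono_less[OF elliptic_F_strict_mono, of "am e s" "am e t"] by simp

lemma am_continuous: "continuous_on S (am e)"
proof -
  have "surj (am e)" by (rule surjI) (rule am_elliptic_F)
  then have "continuous_on UNIV (am e)"
    using am_less_iff by (intro continuous_onI_mono) (auto simp: le_less)
  then show ?thesis by (rule continuous_on_subset) simp
qed

lemma am_deriv: "(am e has_real_derivative Delta e (am e t)) (at t)"
proof -
  have "isCont (am e) t"
    using am_continuous[of UNIV] by (simp add: continuous_on_eq_continuous_at)
  then show ?thesis
    using DERIV_inverse_function[of "\<lambda>\<phi>. elliptic_F \<phi> e" "1 / Delta e (am e t)" "am e" t "t - 1" "t + 1"]
      elliptic_F_deriv[of "am e t"] Delta_pos[of "am e t"] by simp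
qed

lemma elliptic_F_minus: "elliptic_F (- x) e = - elliptic_F x e"
proof -
  have "((\<lambda>u. elliptic_F u e + elliptic_F (- u) e) has_real_derivative 0) (at u)" for u
    by (auto intro!: derivative_eq_intros elliptic_F_deriv elliptic_F_deriv[THEN DERIV_chain2]
        simp: Delta_def)
  then have "elliptic_F x e + elliptic_F (- x) e = elliptic_F 0 e + elliptic_F (- 0) e"
    by (intro DERIV_isconst_all) blast
  then show ?thesis by (simp add: elliptic_F_0)
qed

text \<open>The derivative has period \<open>pi\<close>, so the increment over a period is constant; it is evaluated on
the interval from \<open>- pi / 2\<close> to \<open>pi / 2\<close>, where oddness turns it into \<open>2 K\<close>.\<close>

lemma elliptic_F_add_pi: "elliptic_F (x + pi) e = elliptic_F x e + 2 * elliptic_K e"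
proof -
  have "((\<lambda>u. elliptic_F (u + pi) e - elliptic_F u e) has_real_derivative 0) (at u)" for u
    by (auto intro!: derivative_eq_intros elliptic_F_deriv elliptic_F_deriv[THEN DERIV_chain2]
        simp: Delta_def)
  then have "elliptic_F (x + pi) e - elliptic_F x e
      = elliptic_F (- (pi / 2) + pi) e - elliptic_F (- (pi / 2)) e"
    by (intro DERIV_isconst_all) blast
  then show ?thesis by (simp only: elliptic_F_minus) (simp add: elliptic_K_def field_simps)
qed

lemma am_add_2K: "am e (t + 2 * elliptic_K e) = am e t + pi"
  using elliptic_F_add_pi[of "am e t"] by (metis am_elliptic_F elliptic_F_am)

lemma am_0 [simp]: "am e 0 = 0"
  using am_elliptic_F[of 0] by (simp add: elliptic_F_0)

lemma am_minus: "am e (- t) = - am e t"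
  by (metis am_elliptic_F elliptic_F_am elliptic_F_minus)

lemma elliptic_K_pos: "0 < elliptic_K e"
  using elliptic_F_expands[of 0 "pi / 2"] by (simp add: elliptic_K_def elliptic_F_0 field_simps)
    (use pi_gt_zero in linarith)

text \<open>Euler's addition theorem in the form needed for chords: two angles that follow the same flow
\<open>\<theta>' = Delta e \<theta>\<close> with the constant time lag \<open>2 s\<close> satisfy an algebraic relation between their
half-sum \<open>\<sigma>\<close> and half-difference \<open>\<delta>\<close>. Read geometrically, the chords joining them envelop a
fixed ellipse.

The identity \<open>sin\<^sup>2 x - sin\<^sup>2 y = sin (x + y) sin (x - y)\<close> gives
\<open>\<sigma>' \<delta>' = - (e\<^sup>2 / 4) sin (2 \<sigma>) sin (2 \<delta>)\<close>, and differentiating the flow once more gives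
\<open>\<sigma>'' = - (e\<^sup>2 / 2) sin (2 \<sigma>) cos (2 \<delta>)\<close>. Together they make \<open>\<sigma>' / sin (2 \<delta>)\<close> a constant \<open>k\<close>; then
\<open>\<delta>' = - (e\<^sup>2 / (4 k)) sin (2 \<sigma>)\<close>, so a suitable combination of \<open>cos\<^sup>2 \<delta>\<close>, \<open>cos\<^sup>2 \<sigma>\<close> and
\<open>sin\<^sup>2 \<sigma>\<close> is constant as well. At \<open>t = 0\<close> one has \<open>\<sigma> = 0\<close> and \<open>\<delta> = \<omega>\<close>, which fixes both constants.\<close>

lemma euler_addition:
  fixes s t :: real
  assumes s: "0 < s" "s < elliptic_K e"
  defines "\<omega> \<equiv> am e s"
    and "\<sigma> \<equiv> \<lambda>t. (am e (t + s) + am e (t - s)) / 2"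
    and "\<delta> \<equiv> \<lambda>t. (am e (t + s) - am e (t - s)) / 2"
  shows "0 < \<delta> t" "\<delta> t < pi / 2"
    "(cos (\<delta> t))\<^sup>2 = (cos \<omega>)\<^sup>2 * ((cos (\<sigma> t))\<^sup>2 + (sin (\<sigma> t))\<^sup>2 / (Delta e \<omega>)\<^sup>2)"
proof -
  (* The time lag lies strictly between 0 and 2 K, which is the time of an advance by pi. *)
  have d: "0 < \<delta> t" "\<delta> t < pi / 2" for t
    using am_less_iff[of "t - s" "t + s"] am_less_iff[of "t + s" "t - s + 2 * elliptic_K e"] s
    by (auto simp: \<delta>_def am_add_2K simp del: am_less_iff)
  then show "0 < \<delta> t" "\<delta> t < pi / 2" by blast+
  define D0 where "D0 = (\<lambda>t. Delta e (am e (t - s)))"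
  define D1 where "D1 = (\<lambda>t. Delta e (am e (t + s)))"
  have sin2d: "0 < sin (2 * \<delta> t)" for t
    using d[of t] by (intro sin_gt_zero) auto
  have th: "am e (t + s) = \<sigma> t + \<delta> t" "am e (t - s) = \<sigma> t - \<delta> t" for t
    by (simp_all add: \<sigma>_def \<delta>_def field_simps)
  have am': "((\<lambda>t. am e (t + s)) has_real_derivative D1 t) (at t)"
    "((\<lambda>t. am e (t - s)) has_real_derivative D0 t) (at t)" for t
    using am_deriv[of "t + s"] am_deriv[of "t + - s", unfolded DERIV_shift]
    by (simp_all add: DERIV_shift D0_def D1_def)
  have \<sigma>': "(\<sigma> has_real_derivative (D1 t + D0 t) / 2) (at t)"
    and \<delta>': "(\<delta> has_real_derivative (D1 t - D0 t) / 2) (at t)" for t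
    unfolding \<sigma>_def \<delta>_def by (auto intro!: derivative_eq_intros am')
  have rad: "((\<lambda>t. sqrt (1 - e\<^sup>2 * (sin (f t))\<^sup>2)) has_real_derivative
        - (e\<^sup>2 / 2) * sin (2 * f t)) (at t)"
    if "(f has_real_derivative Delta e (f t)) (at t)" for f :: "real \<Rightarrow> real" and t
  proof -
    show ?thesis
      using Delta_radicand_pos[of "f t"]
      by (auto intro!: derivative_eq_intros that simp: Delta_def sin_double divide_simps)
  qed
  have D': "(D1 has_real_derivative - (e\<^sup>2 / 2) * sin (2 * am e (t + s))) (at t)"
    "(D0 has_real_derivative - (e\<^sup>2 / 2) * sin (2 * am e (t - s))) (at t)" for t
    using rad[of "\<lambda>t. am e (t + s)" t] rad[of "\<lambda>t. am e (t - s)" t] am'[of t]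
    by (auto simp: D0_def D1_def Delta_def[abs_def])
  have prod: "(D1 t + D0 t) * (D1 t - D0 t) = - e\<^sup>2 * sin (2 * \<sigma> t) * sin (2 * \<delta> t)" for t
  proof -
    have "(D1 t + D0 t) * (D1 t - D0 t) = (D1 t)\<^sup>2 - (D0 t)\<^sup>2"
      by (simp add: power2_eq_square algebra_simps)
    also have "\<dots> = - e\<^sup>2 * ((sin (\<sigma> t + \<delta> t))\<^sup>2 - (sin (\<sigma> t - \<delta> t))\<^sup>2)"
      by (simp add: D0_def D1_def Delta_square th algebra_simps)
    also have "(sin (\<sigma> t + \<delta> t))\<^sup>2 - (sin (\<sigma> t - \<delta> t))\<^sup>2 = sin (2 * \<sigma> t) * sin (2 * \<delta> t)"
      unfolding sin_double by (simp add: sin_add sin_diff power2_eq_square algebra_simps)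
    finally show ?thesis by simp
  qed
  (* The first integral of the motion. *)
  define E where "E = (\<lambda>t. (D1 t + D0 t) / 2 / sin (2 * \<delta> t))"
  have sums: "sin (2 * am e (t + s)) + sin (2 * am e (t - s)) = 2 * sin (2 * \<sigma> t) * cos (2 * \<delta> t)" for t
    by (simp add: th distrib_left right_diff_distrib sin_add sin_diff)
  have E': "(E has_real_derivative 0) (at t)" for t
  proof -
    have "((\<lambda>t. (D1 t + D0 t) / 2) has_real_derivative
        - (e\<^sup>2 / 2) * (sin (2 * am e (t + s)) + sin (2 * am e (t - s))) / 2) (at t)"
      by (auto intro!: derivative_eq_intros D' simp: field_simps)
    moreover have "((\<lambda>t. sin (2 * \<delta> t)) has_real_derivative
        cos (2 * \<delta> t) * (D1 t - D0 t)) (at t)"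
      by (auto intro!: derivative_eq_intros \<delta>')
    moreover have "sin (2 * \<delta> t) \<noteq> 0" using sin2d[of t] by simp
    ultimately have "(E has_real_derivative
       ((- (e\<^sup>2 / 2) * (sin (2 * am e (t + s)) + sin (2 * am e (t - s))) / 2) * sin (2 * \<delta> t)
         - (D1 t + D0 t) / 2 * (cos (2 * \<delta> t) * (D1 t - D0 t))) / (sin (2 * \<delta> t) * sin (2 * \<delta> t))) (at t)"
      unfolding E_def by (rule DERIV_divide)
    also have "(- (e\<^sup>2 / 2) * (sin (2 * am e (t + s)) + sin (2 * am e (t - s))) / 2) * sin (2 * \<delta> t)
         - (D1 t + D0 t) / 2 * (cos (2 * \<delta> t) * (D1 t - D0 t))
       = - (e\<^sup>2 / 2) * sin (2 * \<sigma> t) * cos (2 * \<delta> t) * sin (2 * \<delta> t)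
         - cos (2 * \<delta> t) / 2 * ((D1 t + D0 t) * (D1 t - D0 t))"
      unfolding sums by (simp add: field_simps)
    also have "\<dots> = 0" unfolding prod by (simp add: algebra_simps)
    finally show ?thesis by simp
  qed
  have at0: "\<sigma> 0 = 0" "\<delta> 0 = \<omega>" by (simp_all add: \<sigma>_def \<delta>_def \<omega>_def am_minus)
  define k where "k = Delta e \<omega> / sin (2 * \<omega>)"
  have "E 0 = k"
    using at0 by (simp add: E_def k_def D1_def D0_def am_minus \<omega>_def Delta_def)
  then have E: "E t = k" for t
    using DERIV_isconst_all[of E t 0] E' by simp
  have s2w: "0 < sin (2 * \<omega>)" using sin2d[of 0] at0 by simp
  have kpos: "k > 0" using s2w by (simp add: k_def Delta_pos)
  have sum': "(D1 t + D0 t) / 2 = k * sin (2 * \<delta> t)" for t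
    using E[of t] sin2d[of t] by (simp add: E_def field_simps)
  have diff': "(D1 t - D0 t) / 2 = - (e\<^sup>2 / (4 * k)) * sin (2 * \<sigma> t)" for t
  proof -
    have "D1 t + D0 t = 2 * k * sin (2 * \<delta> t)" using sum'[of t] by simp
    then have "sin (2 * \<delta> t) * (2 * k * (D1 t - D0 t)) = sin (2 * \<delta> t) * (- e\<^sup>2 * sin (2 * \<sigma> t))"
      using prod[of t] by (metis (no_types) mult.assoc mult.commute)
    then have "2 * k * (D1 t - D0 t) = - e\<^sup>2 * sin (2 * \<sigma> t)"
      using sin2d[of t] by (metis less_irrefl mult_cancel_left)
    then show ?thesis using kpos by (simp add: field_simps)
  qed
  define \<alpha> where "\<alpha> = (cos \<omega>)\<^sup>2"
  define \<beta> where "\<beta> = (cos \<omega>)\<^sup>2 / (Delta e \<omega>)\<^sup>2"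
  (* This ratio is what makes the two terms of the derivative of W below cancel. *)
  have ab: "\<alpha> - \<beta> = - e\<^sup>2 / (4 * k\<^sup>2)"
  proof -
    have "sin \<omega> \<noteq> 0" "cos \<omega> \<noteq> 0" using s2w by (auto simp: sin_double)
    then have "- e\<^sup>2 / (4 * k\<^sup>2) = (cos \<omega>)\<^sup>2 * (- e\<^sup>2 * (sin \<omega>)\<^sup>2) / (Delta e \<omega>)\<^sup>2"
      unfolding k_def sin_double power_divide power_mult_distrib by simp
    also have "\<dots> = (cos \<omega>)\<^sup>2 * ((Delta e \<omega>)\<^sup>2 - 1) / (Delta e \<omega>)\<^sup>2"
      by (simp add: Delta_square)
    also have "\<dots> = \<alpha> - \<beta>"
      using Delta_pos[of \<omega>] by (simp add: \<alpha>_def \<beta>_def field_simps)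
    finally show ?thesis by simp
  qed
  define W where "W = (\<lambda>t. (cos (\<delta> t))\<^sup>2 - (\<alpha> * (cos (\<sigma> t))\<^sup>2 + \<beta> * (sin (\<sigma> t))\<^sup>2))"
  have W': "(W has_real_derivative 0) (at t)" for t
  proof -
    have cos2: "((\<lambda>t. (cos (f t))\<^sup>2) has_real_derivative - (sin (2 * f t) * f')) (at t)"
      and sin2: "((\<lambda>t. (sin (f t))\<^sup>2) has_real_derivative sin (2 * f t) * f') (at t)"
      if "(f has_real_derivative f') (at t)" for f f'
      unfolding sin_double by (auto intro!: derivative_eq_intros that)
    have "(W has_real_derivative - (sin (2 * \<delta> t) * ((D1 t - D0 t) / 2))
        - (\<alpha> * - (sin (2 * \<sigma> t) * ((D1 t + D0 t) / 2))
         + \<beta> * (sin (2 * \<sigma> t) * ((D1 t + D0 t) / 2)))) (at t)"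
      unfolding W_def by (intro DERIV_diff DERIV_add DERIV_cmult cos2 sin2 \<sigma>' \<delta>')
    also have "- (sin (2 * \<delta> t) * ((D1 t - D0 t) / 2))
        - (\<alpha> * - (sin (2 * \<sigma> t) * ((D1 t + D0 t) / 2))
         + \<beta> * (sin (2 * \<sigma> t) * ((D1 t + D0 t) / 2)))
      = (\<alpha> - \<beta>) * sin (2 * \<sigma> t) * (k * sin (2 * \<delta> t))
         + sin (2 * \<delta> t) * (e\<^sup>2 / (4 * k) * sin (2 * \<sigma> t))"
      unfolding diff' sum' by (simp add: algebra_simps)
    also have "\<dots> = 0"
      unfolding ab using kpos by (simp add: power2_eq_square)
    finally show ?thesis .
  qed
  have "W t = W 0" using DERIV_isconst_all[of W t 0] W' by blast
  then have "W t = 0" by (simp add: W_def at0 \<alpha>_def)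
  then show "(cos (\<delta> t))\<^sup>2 = (cos \<omega>)\<^sup>2 * ((cos (\<sigma> t))\<^sup>2 + (sin (\<sigma> t))\<^sup>2 / (Delta e \<omega>)\<^sup>2)"
    by (simp add: W_def \<alpha>_def \<beta>_def algebra_simps)
qed

end

section \<open>Conics in homogeneous coordinates\<close>

text \<open>Joachimsthal's criterion. With \<open>B\<close> the polar form of the conic, a point
\<open>w = (1 - \<tau>) z0 + \<tau> z1\<close> of the segment is a point of tangency iff it is conjugate to both end
points; eliminating \<open>\<tau>\<close> from these two linear equations leaves a vanishing discriminant. For end
points outside the conic (where \<open>B\<close> is positive) the sign of \<open>B z0 z1\<close> distinguishes a point of
tangency inside the segment from one on its prolongation.\<close>

lemma segment_tangent_iff:
  fixes C :: "real^3^3" and z0 z1 :: "real^2"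
  defines "B \<equiv> \<lambda>x y. hom_coord x \<bullet> (C *v hom_coord y)"
  assumes ne: "z0 \<noteq> z1" and pos: "0 < B z0 z0" "0 < B z1 z1" and sym: "B z1 z0 = B z0 z1"
  shows "segment_tangent C z0 z1 \<longleftrightarrow> B z0 z1 < 0 \<and> (B z0 z1)\<^sup>2 = B z0 z0 * B z1 z1"
proof -
  have hom: "hom_coord ((1 - \<tau>) *\<^sub>R z0 + \<tau> *\<^sub>R z1)
      = (1 - \<tau>) *\<^sub>R hom_coord z0 + \<tau> *\<^sub>R hom_coord z1" for \<tau>
    by (simp add: hom_coord_def vec_eq_iff forall_3)
  have B: "B x ((1 - \<tau>) *\<^sub>R z0 + \<tau> *\<^sub>R z1) = (1 - \<tau>) * B x z0 + \<tau> * B x z1"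
    "B ((1 - \<tau>) *\<^sub>R z0 + \<tau> *\<^sub>R z1) x = (1 - \<tau>) * B z0 x + \<tau> * B z1 x" for x \<tau>
    by (simp_all add: B_def hom inner_simps matrix_vector_right_distrib
        matrix_vector_mult_scaleR)
  have "segment_tangent C z0 z1 \<longleftrightarrow> (\<exists>\<tau>. 0 \<le> \<tau> \<and> \<tau> \<le> 1 \<and>
     (1 - \<tau>) * B z0 z0 + \<tau> * B z0 z1 = 0 \<and> (1 - \<tau>) * B z0 z1 + \<tau> * B z1 z1 = 0)"
    (is "_ \<longleftrightarrow> (\<exists>\<tau>. ?R \<tau>)")
  proof
    assume "segment_tangent C z0 z1"
    then obtain w where "w \<in> closed_segment z0 z1" "B z0 w = 0" "B z1 w = 0"
      by (auto simp: segment_tangent_def tangent_line_def B_def)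
    then show "\<exists>\<tau>. ?R \<tau>"
      by (auto simp: closed_segment_def B sym)
  next
    assume "\<exists>\<tau>. ?R \<tau>"
    then obtain \<tau> where \<tau>: "?R \<tau>" by blast
    define w where "w = (1 - \<tau>) *\<^sub>R z0 + \<tau> *\<^sub>R z1"
    have "B z0 w = 0" "B z1 w = 0" using \<tau> by (simp_all add: w_def B sym)
    moreover from this have "B w w = 0"
      using B(2)[of \<tau> w, folded w_def] by simp
    moreover have "w \<in> closed_segment z0 z1"
      using \<tau> by (auto simp: w_def closed_segment_def)
    ultimately show "segment_tangent C z0 z1"
      using ne by (auto simp: segment_tangent_def conic_curve_def tangent_line_def B_def)
  qed
  (* The parameter of the point of tangency is B z0 z0 / (B z0 z0 - B z0 z1). *)
  also have "\<dots> \<longleftrightarrow> B z0 z1 < 0 \<and> (B z0 z1)\<^sup>2 = B z0 z0 * B z1 z1"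
  proof
    assume "\<exists>\<tau>. ?R \<tau>"
    then obtain \<tau> where \<tau>: "?R \<tau>" by blast
    have "\<tau> \<noteq> 0" "\<tau> \<noteq> 1" using \<tau> pos by auto
    with \<tau> have t: "0 < \<tau>" "0 < 1 - \<tau>" by auto
    have "\<tau> * B z0 z1 = - ((1 - \<tau>) * B z0 z0)" using \<tau> by linarith
    moreover have "(1 - \<tau>) * B z0 z0 > 0" using t pos by simp
    ultimately have neg: "B z0 z1 < 0" using t by (smt (verit) mult_nonneg_nonneg)
    have "(\<tau> * B z0 z1) * ((1 - \<tau>) * B z0 z1) = ((1 - \<tau>) * B z0 z0) * (\<tau> * B z1 z1)"
      using \<tau> by (smt (verit) mult_minus_left mult_minus_right)
    then have "(B z0 z1)\<^sup>2 = B z0 z0 * B z1 z1"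
      using t by (simp add: power2_eq_square)
    with neg show "B z0 z1 < 0 \<and> (B z0 z1)\<^sup>2 = B z0 z0 * B z1 z1" by blast
  next
    assume r: "B z0 z1 < 0 \<and> (B z0 z1)\<^sup>2 = B z0 z0 * B z1 z1"
    define \<tau> where "\<tau> = B z0 z0 / (B z0 z0 - B z0 z1)"
    have d: "B z0 z0 - B z0 z1 > 0" using r pos by linarith
    have 1: "1 - \<tau> = - B z0 z1 / (B z0 z0 - B z0 z1)" using d by (simp add: \<tau>_def field_simps)
    have "?R \<tau>"
      unfolding 1 unfolding \<tau>_def using r d pos
      by (auto simp: field_simps power2_eq_square)
    then show "\<exists>\<tau>. ?R \<tau>" by blast
  qed
  finally show ?thesis .
qed

definition circle_vec :: "real \<Rightarrow> real^3" where
  "circle_vec \<theta> = vector [cos \<theta>, sin \<theta>, 1]"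

definition dehom :: "real^3 \<Rightarrow> real^2" where
  "dehom u = vector [u$1 / u$3, u$2 / u$3]"

lemma circle_vec_nth [simp]:
  "circle_vec \<theta> $ 1 = cos \<theta>" "circle_vec \<theta> $ 2 = sin \<theta>" "circle_vec \<theta> $ 3 = 1"
  by (simp_all add: circle_vec_def)

lemma hom_coord_dehom: "u$3 \<noteq> 0 \<Longrightarrow> hom_coord (dehom u) = (1 / u$3) *\<^sub>R u"
  by (simp add: hom_coord_def dehom_def vec_eq_iff forall_3)

lemma dehom_hom_coord: "dehom (hom_coord z) = z"
  by (simp add: hom_coord_def dehom_def vec_eq_iff forall_2)

lemma dehom_scaleR: "r \<noteq> 0 \<Longrightarrow> dehom (r *\<^sub>R u) = dehom u"
  by (simp add: dehom_def)

lemma hom_coord_3 [simp]: "hom_coord z $ 3 = 1"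
  by (simp add: hom_coord_def)

text \<open>The orientation test of three points is the determinant of their homogeneous coordinates, hence
it is multiplied by \<open>det M\<close> under a projective map \<open>M\<close>, up to positive scalings.\<close>

definition triple :: "real^3 \<Rightarrow> real^3 \<Rightarrow> real^3 \<Rightarrow> real" where
  "triple u v w = det (vector [u, v, w] :: real^3^3)"

lemma orient_eq_triple: "orient a b c = triple (hom_coord a) (hom_coord b) (hom_coord c)"
  by (simp add: orient_def triple_def det_3 hom_coord_def algebra_simps)

lemma triple_scaleR:
  "triple (r *\<^sub>R u) (s *\<^sub>R v) (t *\<^sub>R w) = r * s * t * triple u v w"
  by (simp add: triple_def det_3 algebra_simps)

lemma triple_matrix: "triple (M *v u) (M *v v) (M *v w) = det M * triple u v w"
proof -
  have "(vector [M *v u, M *v v, M *v w] :: real^3^3) = vector [u, v, w] ** transpose M"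
    by (simp add: vec_eq_iff forall_3 matrix_matrix_mult_def matrix_vector_mult_def
        transpose_def sum_3 mult.commute)
  then show ?thesis by (simp add: triple_def det_mul det_transpose)
qed

text \<open>The chord of the unit circle with end points at the angles \<open>\<sigma> - \<delta>\<close> and \<open>\<sigma> + \<delta>\<close> lies on the line
\<open>x cos \<sigma> + y sin \<sigma> = cos \<delta>\<close>. Half-sum and half-difference are therefore the natural coordinates
for chords throughout.\<close>

lemma triple_chord:
  "triple (circle_vec (\<sigma> - \<delta>)) (circle_vec (\<sigma> + \<delta>)) v
   = 2 * sin \<delta> * (v$3 * cos \<delta> - (v$1 * cos \<sigma> + v$2 * sin \<sigma>))"
proof -
  have "triple (circle_vec (\<sigma> - \<delta>)) (circle_vec (\<sigma> + \<delta>)) v =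
    v$1 * (sin (\<sigma> - \<delta>) - sin (\<sigma> + \<delta>)) + v$2 * (cos (\<sigma> + \<delta>) - cos (\<sigma> - \<delta>))
     + v$3 * sin ((\<sigma> + \<delta>) - (\<sigma> - \<delta>))"
    unfolding sin_diff[of "\<sigma> + \<delta>"] by (simp add: triple_def det_3 algebra_simps)
  also have "\<dots> = 2 * sin \<delta> * (v$3 * cos \<delta> - (v$1 * cos \<sigma> + v$2 * sin \<sigma>))"
    using sin_double[of \<delta>] by (simp add: sin_add sin_diff cos_add cos_diff algebra_simps)
  finally show ?thesis .
qed

lemma triple_circle:
  "triple (circle_vec a) (circle_vec b) (circle_vec c)
   = 4 * sin ((b - a) / 2) * sin ((c - b) / 2) * sin ((c - a) / 2)"
proof -
  define \<sigma> \<delta> where "\<sigma> = (a + b) / 2" and "\<delta> = (b - a) / 2"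
  have ab: "a = \<sigma> - \<delta>" "b = \<sigma> + \<delta>" by (simp_all add: \<sigma>_def \<delta>_def field_simps)
  have "cos \<delta> - cos (c - \<sigma>) = 2 * sin ((c - b) / 2) * sin ((c - a) / 2)"
    using cos_diff_cos[of \<delta> "c - \<sigma>"] by (simp add: ab algebra_simps)
  moreover have "triple (circle_vec a) (circle_vec b) (circle_vec c)
      = 2 * sin \<delta> * (cos \<delta> - cos (c - \<sigma>))"
    unfolding ab triple_chord by (simp add: cos_diff algebra_simps)
  ultimately show ?thesis by (simp add: \<delta>_def)
qed

section \<open>A projective frame for two conics\<close>

text \<open>A projective frame in which the outer conic is the unit circle and the inner one is a centred,
axis-parallel ellipse. The condition \<open>upper\<close> says that \<open>M\<close> maps the closed unit disc into the
affine plane without crossing the line at infinity; with \<open>det M > 0\<close> this makes the map orientation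
preserving.\<close>

locale circle_frame =
  fixes M C1 C2 :: "real^3^3" and l1 l2 l3 :: real
  assumes det_pos: "0 < det M"
    and upper: "\<And>x. (x$1)\<^sup>2 + (x$2)\<^sup>2 \<le> (x$3)\<^sup>2 \<Longrightarrow> 0 < x$3 \<Longrightarrow> 0 < (M *v x)$3"
    and form1: "\<And>x y. (M *v x) \<bullet> (C1 *v (M *v y)) = x$1 * y$1 + x$2 * y$2 - x$3 * y$3"
    and form2: "\<And>x y. (M *v x) \<bullet> (C2 *v (M *v y))
      = l1 * (x$1 * y$1) + l2 * (x$2 * y$2) - l3 * (x$3 * y$3)"
    and order: "l2 < l1" "l3 < l2" "0 < l3"
begin

text \<open>The point of the outer conic with eccentric angle \<open>\<theta>\<close> in this frame.\<close>

definition pt :: "real \<Rightarrow> real^2" where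
  "pt \<theta> = dehom (M *v circle_vec \<theta>)"

definition height :: "real \<Rightarrow> real" where
  "height \<theta> = (M *v circle_vec \<theta>) $ 3"

lemma height_pos: "0 < height \<theta>"
  unfolding height_def by (rule upper) simp_all

lemma hom_coord_pt: "hom_coord (pt \<theta>) = (1 / height \<theta>) *\<^sub>R (M *v circle_vec \<theta>)"
  using height_pos[of \<theta>] by (simp add: pt_def hom_coord_dehom height_def)

lemma pt_periodic: "pt (\<theta> + 2 * pi * of_int n) = pt \<theta>"
  by (simp add: pt_def circle_vec_def cos_add sin_add)

lemma pt_fundamental:
  assumes "z \<in> range pt"
  obtains y where "z = pt y" "x \<le> y" "y < x + 2 * pi"
proof -
  obtain y where y: "z = pt y" using assms by blast
  define n where "n = \<lfloor>(y - x) / (2 * pi)\<rfloor>"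
  have "of_int n \<le> (y - x) / (2 * pi)" "(y - x) / (2 * pi) < of_int n + 1"
    by (simp_all add: n_def)
  then have "x \<le> y + 2 * pi * of_int (- n)" "y + 2 * pi * of_int (- n) < x + 2 * pi"
    by (simp_all add: field_simps)
  then show thesis using that[of "y + 2 * pi * of_int (- n)"] y by (simp only: pt_periodic)
qed

lemma pt_continuous: "continuous_on S pt"
proof -
  have "continuous_on S (\<lambda>\<theta>. (M *v circle_vec \<theta>) $ i)" for i
    by (auto simp: matrix_vector_mult_def sum_3 intro!: continuous_intros)
  moreover have "(M *v circle_vec \<theta>) $ 3 \<noteq> 0" for \<theta>
    using height_pos[of \<theta>] by (simp add: height_def)
  ultimately have "continuous_on S (\<lambda>\<theta>. (M *v circle_vec \<theta>) $ i / (M *v circle_vec \<theta>) $ 3)" for i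
    by (intro continuous_on_divide) auto
  then have "continuous_on S (\<lambda>\<theta>. pt \<theta> $ i)" for i
    using exhaust_2[of i] by (auto simp: pt_def dehom_def)
  then show ?thesis
    using continuous_on_vec_lambda[of S "\<lambda>i \<theta>. pt \<theta> $ i"] by simp
qed

text \<open>Every affine point has frame coordinates, and those of a point of the closed disc come with a
positive third coordinate: otherwise \<open>- v\<close> would be in the upper half cone, and \<open>upper\<close> would
give it a positive last homogeneous coordinate.\<close>

lemma obtain_frame_coord:
  obtains v where "hom_coord w = M *v v" "(v$1)\<^sup>2 + (v$2)\<^sup>2 \<le> (v$3)\<^sup>2 \<Longrightarrow> 0 < v$3"
proof -
  have "invertible M" using det_pos by (simp add: invertible_det_nz)
  then obtain M' where "M ** M' = mat 1" by (auto simp: invertible_def)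
  then have M': "M *v (M' *v hom_coord w) = hom_coord w"
    by (simp add: matrix_vector_mul_assoc)
  define v where "v = M' *v hom_coord w"
  have v: "M *v v = hom_coord w" using M' by (simp add: v_def)
  have "0 < v$3" if le: "(v$1)\<^sup>2 + (v$2)\<^sup>2 \<le> (v$3)\<^sup>2"
  proof (rule ccontr)
    assume "\<not> 0 < v$3"
    then consider "v$3 = 0" | "v$3 < 0" by linarith
    then show False
    proof cases
      case 1
      with le have "(v$1)\<^sup>2 = 0 \<and> (v$2)\<^sup>2 = 0"
        using zero_le_power2[of "v$1"] zero_le_power2[of "v$2"] by (auto simp: sum_power2_le_zero_iff)
      then have "v = 0" using 1 by (simp add: vec_eq_iff forall_3)
      then have "hom_coord w = 0" using v by simp
      then have "hom_coord w $ 3 = 0" by simp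
      then show False by simp
    next
      case 2
      have "0 < (M *v (- v)) $ 3" using le 2 by (intro upper) simp_all
      also have "M *v (- v) = - hom_coord w"
        using v matrix_vector_mult_scaleR[of M "-1" v] by simp
      finally show False by simp
    qed
  qed
  then show thesis using that v by metis
qed

lemma conic_curve_C1: "conic_curve C1 = range pt"
proof (intro equalityI subsetI)
  fix w assume w: "w \<in> conic_curve C1"
  obtain v where v: "hom_coord w = M *v v" and up: "(v$1)\<^sup>2 + (v$2)\<^sup>2 \<le> (v$3)\<^sup>2 \<Longrightarrow> 0 < v$3"
    by (rule obtain_frame_coord) blast
  have eq: "(v$1)\<^sup>2 + (v$2)\<^sup>2 = (v$3)\<^sup>2"
    using w form1[of v v] by (simp add: conic_curve_def v power2_eq_square)
  then have pos: "0 < v$3" using up by simp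
  have "(v$1 / v$3)\<^sup>2 + (v$2 / v$3)\<^sup>2 = 1"
    using eq pos by (simp add: power_divide flip: add_divide_distrib)
  then obtain \<theta> where "v$1 / v$3 = cos \<theta>" "v$2 / v$3 = sin \<theta>"
    using sincos_total_2pi by metis
  then have "v = v$3 *\<^sub>R circle_vec \<theta>"
    using pos by (simp add: vec_eq_iff forall_3 field_simps)
  then have "hom_coord w = v$3 *\<^sub>R (M *v circle_vec \<theta>)"
    unfolding v by (metis matrix_vector_mult_scaleR)
  then have "w = pt \<theta>"
    unfolding pt_def using pos dehom_scaleR[of "v$3"] dehom_hom_coord[of w] by simp
  then show "w \<in> range pt" by blast
next
  fix w assume "w \<in> range pt"
  then obtain \<theta> where "w = pt \<theta>" by blast
  then show "w \<in> conic_curve C1"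
    using form1[of "circle_vec \<theta>" "circle_vec \<theta>"]
    by (simp add: conic_curve_def hom_coord_pt matrix_vector_mult_scaleR flip: power2_eq_square)
qed

lemma orient_pt:
  "orient (pt a) (pt b) (pt c) =
     det M / (height a * height b * height c)
       * (4 * sin ((b - a) / 2) * sin ((c - b) / 2) * sin ((c - a) / 2))"
  unfolding orient_eq_triple hom_coord_pt triple_scaleR triple_matrix triple_circle by simp

lemma orient_pt_pos:
  assumes "a < b" "b < c" "c < a + 2 * pi"
  shows "0 < orient (pt a) (pt b) (pt c)"
proof -
  have "0 < sin ((b - a) / 2)" "0 < sin ((c - b) / 2)" "0 < sin ((c - a) / 2)"
    using assms by (auto intro!: sin_gt_zero)
  then show ?thesis
    using det_pos height_pos unfolding orient_pt by simp
qed

lemma pt_inj: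
  assumes "a < b" "b < a + 2 * pi" shows "pt a \<noteq> pt b"
proof
  assume "pt a = pt b"
  then have "orient (pt a) (pt ((a + b) / 2)) (pt b) = 0"
    by (simp add: orient_def algebra_simps)
  with orient_pt_pos[of a "(a + b) / 2" b] assms show False by simp
qed

end

section \<open>Chords of the circle tangent to an inner ellipse\<close>

text \<open>In the frame, the member \<open>\<nu>\<close> of the pencil is the ellipse \<open>a x\<^sup>2 + b y\<^sup>2 = c\<close>.\<close>

locale inner_conic = circle_frame +
  fixes \<nu> :: "real^2"
  assumes nu: "0 < \<nu>$2" "0 < \<nu>$1 + l3 * \<nu>$2"
begin

definition a where "a = \<nu>$1 + l1 * \<nu>$2"
definition b where "b = \<nu>$1 + l2 * \<nu>$2"
definition c where "c = \<nu>$1 + l3 * \<nu>$2"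

lemma abc: "0 < c" "c < b" "b < a"
  using nu order by (simp_all add: a_def b_def c_def)

lemma form_pencil: "(M *v x) \<bullet> (pencil C1 C2 \<nu> *v (M *v y))
    = a * (x$1 * y$1) + b * (x$2 * y$2) - c * (x$3 * y$3)"
proof -
  have "pencil C1 C2 \<nu> *v u = \<nu>$1 *\<^sub>R (C1 *v u) + \<nu>$2 *\<^sub>R (C2 *v u)" for u
    by (simp add: pencil_def matrix_vector_mult_add_rdistrib scaleR_matrix_vector_assoc)
  then show ?thesis
    by (simp add: inner_simps form1 form2 a_def b_def c_def algebra_simps)
qed

abbreviation q where
  "q x y \<equiv> a * (cos x * cos y) + b * (sin x * sin y) - c"

lemma form_pt: "hom_coord (pt x) \<bullet> (pencil C1 C2 \<nu> *v hom_coord (pt y))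
    = q x y / (height x * height y)"
  using form_pencil[of "circle_vec x" "circle_vec y"]
  by (simp add: hom_coord_pt matrix_vector_mult_scaleR)

text \<open>The discriminant of the tangency criterion is the value of the dual conic on the line of the chord,
which gives \<open>c cos\<^sup>2 \<sigma> / a + c sin\<^sup>2 \<sigma> / b = cos\<^sup>2 \<delta>\<close>. The sign condition on the polar form follows
from this relation, because the end points are on the circle and \<open>c\<close> is smaller than \<open>a\<close> and \<open>b\<close>.\<close>

lemma segment_tangent_pt:
  assumes \<delta>: "0 < \<delta>" "\<delta> < pi"
  shows "segment_tangent (pencil C1 C2 \<nu>) (pt (\<sigma> - \<delta>)) (pt (\<sigma> + \<delta>)) \<longleftrightarrow>
    a * b * (cos \<delta>)\<^sup>2 = c * (b * (cos \<sigma>)\<^sup>2 + a * (sin \<sigma>)\<^sup>2)"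
proof -
  define x y where "x = \<sigma> - \<delta>" and "y = \<sigma> + \<delta>"
  have qpos: "0 < q t t" for t
  proof -
    have "c = c * ((cos t)\<^sup>2 + (sin t)\<^sup>2)" by simp
    also have "\<dots> < a * (cos t)\<^sup>2 + b * (sin t)\<^sup>2"
    proof (cases "sin t = 0")
      case True
      then have "(cos t)\<^sup>2 = 1" using sin_cos_squared_add[of t] by simp
      then show ?thesis using True abc by simp
    next
      case False
      then have "c * (sin t)\<^sup>2 < b * (sin t)\<^sup>2" using abc by simp
      moreover have "c * (cos t)\<^sup>2 \<le> a * (cos t)\<^sup>2" using abc by (intro mult_right_mono) auto
      ultimately show ?thesis unfolding distrib_left by linarith
    qed
    finally show ?thesis by (simp add: power2_eq_square)
  qed
  have "pt x \<noteq> pt y" using pt_inj[of x y] \<delta> by (simp add: x_def y_def)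
  then have "segment_tangent (pencil C1 C2 \<nu>) (pt x) (pt y) \<longleftrightarrow>
    q x y / (height x * height y) < 0 \<and>
    (q x y / (height x * height y))\<^sup>2 = q x x / (height x * height x) * (q y y / (height y * height y))"
    using segment_tangent_iff[of "pt x" "pt y" "pencil C1 C2 \<nu>", unfolded form_pt]
      qpos height_pos by (simp add: mult.commute)
  also have "\<dots> \<longleftrightarrow> q x y < 0 \<and> (q x y)\<^sup>2 = q x x * q y y"
  proof -
    have "Q / (h * k) < 0 \<and> (Q / (h * k))\<^sup>2 = A / (h * h) * (B / (k * k)) \<longleftrightarrow> Q < 0 \<and> Q\<^sup>2 = A * B"
      if "0 < h" "0 < k" for Q h k A B :: real
    proof -
      have "Q / (h * k) < 0 \<longleftrightarrow> Q < 0"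
        using mult_pos_pos[OF that] by (simp add: divide_less_0_iff)
      moreover have "(Q / (h * k))\<^sup>2 = Q\<^sup>2 / (h * h * (k * k))"
        by (simp add: power2_eq_square mult_ac)
      ultimately show ?thesis using that by simp
    qed
    from this[OF height_pos height_pos] show ?thesis .
  qed
  also have "(q x y)\<^sup>2 = q x x * q y y \<longleftrightarrow>
    a * b * (cos \<delta>)\<^sup>2 = c * (b * (cos \<sigma>)\<^sup>2 + a * (sin \<sigma>)\<^sup>2)"
  proof -
    have "q x x * q y y - (q x y)\<^sup>2 = a * b * (cos x * sin y - cos y * sin x)\<^sup>2
        - a * c * (cos x - cos y)\<^sup>2 - b * c * (sin x - sin y)\<^sup>2"
      by (simp add: power2_eq_square algebra_simps)
    also have "cos x * sin y - cos y * sin x = 2 * sin \<delta> * cos \<delta>"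
      using sin_diff[of y x] sin_double[of \<delta>] by (simp add: x_def y_def algebra_simps)
    also have "cos x - cos y = 2 * sin \<sigma> * sin \<delta>"
      by (simp add: x_def y_def cos_add cos_diff)
    also have "sin x - sin y = - 2 * cos \<sigma> * sin \<delta>"
      by (simp add: x_def y_def sin_add sin_diff)
    finally have "q x x * q y y - (q x y)\<^sup>2
        = 4 * (sin \<delta>)\<^sup>2 * (a * b * (cos \<delta>)\<^sup>2 - c * (b * (cos \<sigma>)\<^sup>2 + a * (sin \<sigma>)\<^sup>2))"
      by (simp add: power2_eq_square algebra_simps)
    moreover have "sin \<delta> > 0" using \<delta> by (rule sin_gt_zero)
    ultimately show ?thesis by (smt (verit) mult_eq_0_iff power_eq_0_iff)
  qed
  also have "q x y < 0 \<and> a * b * (cos \<delta>)\<^sup>2 = c * (b * (cos \<sigma>)\<^sup>2 + a * (sin \<sigma>)\<^sup>2) \<longleftrightarrow>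
      a * b * (cos \<delta>)\<^sup>2 = c * (b * (cos \<sigma>)\<^sup>2 + a * (sin \<sigma>)\<^sup>2)"
  proof -
    have "q x y < 0" if r: "a * b * (cos \<delta>)\<^sup>2 = c * (b * (cos \<sigma>)\<^sup>2 + a * (sin \<sigma>)\<^sup>2)"
    proof -
      have "cos x * cos y = (cos \<delta>)\<^sup>2 - (sin \<sigma>)\<^sup>2"
      proof -
        have "cos x * cos y = (cos \<sigma>)\<^sup>2 * (cos \<delta>)\<^sup>2 - (sin \<sigma>)\<^sup>2 * (sin \<delta>)\<^sup>2"
          by (simp add: x_def y_def cos_add cos_diff power2_eq_square algebra_simps)
        then show ?thesis by (simp add: cos_squared_eq[of \<sigma>] sin_squared_eq[of \<delta>] algebra_simps)
      qed
      moreover have "sin x * sin y = (cos \<delta>)\<^sup>2 - (cos \<sigma>)\<^sup>2"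
      proof -
        have "sin x * sin y = (sin \<sigma>)\<^sup>2 * (cos \<delta>)\<^sup>2 - (cos \<sigma>)\<^sup>2 * (sin \<delta>)\<^sup>2"
          by (simp add: x_def y_def sin_add sin_diff power2_eq_square algebra_simps)
        then show ?thesis by (simp add: sin_squared_eq algebra_simps)
      qed
      ultimately have "q x y = a * ((cos \<delta>)\<^sup>2 - (sin \<sigma>)\<^sup>2) + b * ((cos \<delta>)\<^sup>2 - (cos \<sigma>)\<^sup>2) - c"
        by simp
      then have "a * b * q x y = a * b * (a * ((cos \<delta>)\<^sup>2 - (sin \<sigma>)\<^sup>2)
          + b * ((cos \<delta>)\<^sup>2 - (cos \<sigma>)\<^sup>2) - c)" by presburger
      also have "\<dots> = (a + b) * (a * b * (cos \<delta>)\<^sup>2)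
          - a * b * (a * (sin \<sigma>)\<^sup>2 + b * (cos \<sigma>)\<^sup>2 + c * ((cos \<sigma>)\<^sup>2 + (sin \<sigma>)\<^sup>2))"
        by (simp add: algebra_simps)
      also have "\<dots> = - (b * b * (a - c) * (cos \<sigma>)\<^sup>2 + a * a * (b - c) * (sin \<sigma>)\<^sup>2)"
        unfolding r by algebra
      also have "\<dots> < 0"
      proof -
        define m where "m = min (b * b * (a - c)) (a * a * (b - c))"
        have m: "0 < m" "m \<le> b * b * (a - c)" "m \<le> a * a * (b - c)"
          using abc by (auto simp: m_def)
        have "m * ((cos \<sigma>)\<^sup>2 + (sin \<sigma>)\<^sup>2)
            \<le> b * b * (a - c) * (cos \<sigma>)\<^sup>2 + a * a * (b - c) * (sin \<sigma>)\<^sup>2"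
          unfolding distrib_left by (intro add_mono mult_right_mono m) auto
        then show ?thesis using m by simp
      qed
      finally show ?thesis using abc by (simp add: mult_less_0_iff zero_less_mult_iff)
    qed
    then show ?thesis by blast
  qed
  finally show ?thesis unfolding x_def y_def .
qed

lemma orient_pt_dehom:
  assumes "hom_coord w = r *\<^sub>R (M *v v)"
  shows "orient (pt (\<sigma> - \<delta>)) (pt (\<sigma> + \<delta>)) w =
    r * det M / (height (\<sigma> - \<delta>) * height (\<sigma> + \<delta>)) *
      (2 * sin \<delta> * (v$3 * cos \<delta> - (v$1 * cos \<sigma> + v$2 * sin \<sigma>)))"
  unfolding orient_eq_triple hom_coord_pt assms triple_scaleR triple_matrix triple_chord by simp

text \<open>The tangency relation determines only \<open>cos\<^sup>2 \<delta>\<close>; the side on which the ellipse lies determines the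
sign of \<open>cos \<delta>\<close>. If the ellipse is on the left, testing the two vertices on the \<open>x\<close>-axis and adding
gives \<open>cos \<delta> \<ge> 0\<close>, and the relation excludes \<open>cos \<delta> = 0\<close>. Conversely, the Cauchy-Schwarz inequality for the form \<open>a x\<^sup>2 + b y\<^sup>2\<close> bounds
\<open>x cos \<sigma> + y sin \<sigma>\<close> on the ellipse by \<open>cos \<delta>\<close>.\<close>

lemma lies_left_pt:
  assumes \<delta>: "0 < \<delta>" "\<delta> < pi"
    and rel: "a * b * (cos \<delta>)\<^sup>2 = c * (b * (cos \<sigma>)\<^sup>2 + a * (sin \<sigma>)\<^sup>2)"
  shows "lies_left (conic_curve (pencil C1 C2 \<nu>)) (pt (\<sigma> - \<delta>)) (pt (\<sigma> + \<delta>)) \<longleftrightarrow> 0 < cos \<delta>"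
proof
  have sin: "0 < sin \<delta>" using \<delta> by (rule sin_gt_zero)
  assume left: "lies_left (conic_curve (pencil C1 C2 \<nu>)) (pt (\<sigma> - \<delta>)) (pt (\<sigma> + \<delta>))"
  have *: "0 \<le> cos \<delta> - x * cos \<sigma>" if x: "x\<^sup>2 = c / a" for x
  proof -
    define v :: "real^3" where "v = vector [x, 0, 1]"
    define r where "r = (M *v v) $ 3"
    have "x\<^sup>2 \<le> 1" using abc x by simp
    then have r: "0 < r" unfolding r_def by (intro upper) (simp_all add: v_def)
    have hom: "hom_coord (dehom (M *v v)) = (1 / r) *\<^sub>R (M *v v)"
      using r by (simp add: hom_coord_dehom r_def)
    have "(M *v v) \<bullet> (pencil C1 C2 \<nu> *v (M *v v)) = 0"
      using abc x unfolding form_pencil by (simp add: v_def flip: power2_eq_square)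
    then have "dehom (M *v v) \<in> conic_curve (pencil C1 C2 \<nu>)"
      by (simp add: conic_curve_def hom matrix_vector_mult_scaleR)
    then have "0 \<le> orient (pt (\<sigma> - \<delta>)) (pt (\<sigma> + \<delta>)) (dehom (M *v v))"
      using left by (auto simp: lies_left_def)
    moreover define k where "k = 1 / r * det M / (height (\<sigma> - \<delta>) * height (\<sigma> + \<delta>))"
    ultimately have "0 \<le> k * (2 * sin \<delta> * (cos \<delta> - x * cos \<sigma>))"
      using orient_pt_dehom[OF hom] by (simp add: v_def)
    moreover have "0 < k" using r det_pos height_pos by (simp add: k_def)
    ultimately show ?thesis using sin by (simp add: zero_le_mult_iff)
  qed
  have "0 \<le> cos \<delta>"
    using *[of "sqrt (c / a)"] *[of "- sqrt (c / a)"] abc by simp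
  moreover have "cos \<delta> \<noteq> 0"
  proof
    assume "cos \<delta> = 0"
    then have "b * (cos \<sigma>)\<^sup>2 + a * (sin \<sigma>)\<^sup>2 = 0" using rel abc by simp
    moreover have "b * ((cos \<sigma>)\<^sup>2 + (sin \<sigma>)\<^sup>2) \<le> b * (cos \<sigma>)\<^sup>2 + a * (sin \<sigma>)\<^sup>2"
      using abc unfolding distrib_left by (intro add_mono mult_right_mono) auto
    ultimately show False using abc by simp
  qed
  ultimately show "0 < cos \<delta>" by simp
next
  have sin: "0 < sin \<delta>" using \<delta> by (rule sin_gt_zero)
  assume cos: "0 < cos \<delta>"
  show "lies_left (conic_curve (pencil C1 C2 \<nu>)) (pt (\<sigma> - \<delta>)) (pt (\<sigma> + \<delta>))"
    unfolding lies_left_def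
  proof
    fix w assume w: "w \<in> conic_curve (pencil C1 C2 \<nu>)"
    obtain v where v: "hom_coord w = M *v v" and up: "(v$1)\<^sup>2 + (v$2)\<^sup>2 \<le> (v$3)\<^sup>2 \<Longrightarrow> 0 < v$3"
      by (rule obtain_frame_coord) blast
    have eq: "a * (v$1)\<^sup>2 + b * (v$2)\<^sup>2 = c * (v$3)\<^sup>2"
      using w form_pencil[of v v] by (simp add: conic_curve_def v power2_eq_square)
    have "c * ((v$1)\<^sup>2 + (v$2)\<^sup>2) \<le> a * (v$1)\<^sup>2 + b * (v$2)\<^sup>2"
      using abc unfolding distrib_left by (intro add_mono mult_right_mono) auto
    then have pos: "0 < v$3" using up abc unfolding eq by simp
    have "v$1 * cos \<sigma> + v$2 * sin \<sigma> \<le> v$3 * cos \<delta>"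
    proof (rule power2_le_imp_le)
      (* The Lagrange identity behind Cauchy-Schwarz. *)
      have "a * b * (v$1 * cos \<sigma> + v$2 * sin \<sigma>)\<^sup>2 + (a * v$1 * sin \<sigma> - b * v$2 * cos \<sigma>)\<^sup>2
          = (a * (v$1)\<^sup>2 + b * (v$2)\<^sup>2) * (b * (cos \<sigma>)\<^sup>2 + a * (sin \<sigma>)\<^sup>2)"
        by (simp add: power2_eq_square algebra_simps)
      also have "\<dots> = a * b * (v$3 * cos \<delta>)\<^sup>2"
        unfolding eq power_mult_distrib using rel by (simp add: mult_ac)
      finally have "a * b * (v$1 * cos \<sigma> + v$2 * sin \<sigma>)\<^sup>2 \<le> a * b * (v$3 * cos \<delta>)\<^sup>2"
        by (smt (verit) zero_le_power2)
      then show "(v$1 * cos \<sigma> + v$2 * sin \<sigma>)\<^sup>2 \<le> (v$3 * cos \<delta>)\<^sup>2"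
        using abc by simp
    qed (use pos cos in simp)
    then show "0 \<le> orient (pt (\<sigma> - \<delta>)) (pt (\<sigma> + \<delta>)) w"
      using orient_pt_dehom[of w 1 v] v det_pos sin
      by (auto intro!: divide_nonneg_pos mult_nonneg_nonneg mult_pos_pos height_pos)
  qed
qed

abbreviation e where "e \<equiv> modulus l1 l2 l3"

text \<open>Half of the time by which the Poncelet map advances along the flow of the amplitude.\<close>

definition s where "s = elliptic_F (omega l1 l3 \<nu>) e"

lemma e_square: "e\<^sup>2 = (l1 - l2) / (l1 - l3)"
  using order by (simp add: modulus_def)

lemma e_less_1: "e\<^sup>2 < 1"
  using order by (simp add: e_square)

text \<open>The modulus does not involve \<open>\<nu>\<close>, and the angle \<open>omega\<close> is chosen such that the constants of
\<open>euler_addition\<close> become the coefficients of the ellipse: \<open>cos\<^sup>2 \<omega> = c / a\<close> and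
\<open>Delta e \<omega>\<^sup>2 = b / a\<close>. So a single flow serves the whole pencil.\<close>

lemma omega_facts:
  shows "am e s = omega l1 l3 \<nu>" "0 < s" "s < elliptic_K e"
    "a * (cos (omega l1 l3 \<nu>))\<^sup>2 = c" "a * (Delta e (omega l1 l3 \<nu>))\<^sup>2 = b"
proof -
  define m where "m = (l1 - l3) * \<nu>$2 / a"
  have apos: "0 < a" using abc by simp
  have m: "0 < m" "m < 1" using nu order apos by (auto simp: m_def a_def algebra_simps)
  have omega: "omega l1 l3 \<nu> = arcsin (sqrt m)"
    by (simp add: omega_def m_def a_def add.commute)
  have sin: "sin (omega l1 l3 \<nu>) = sqrt m"
    unfolding omega using m by (intro sin_arcsin) (auto intro: order_trans[of "-1" 0])
  have range: "0 < omega l1 l3 \<nu>" "omega l1 l3 \<nu> < pi / 2"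
    using m arcsin_less_mono[of 0 "sqrt m"] arcsin_less_mono[of "sqrt m" 1]
    by (auto simp: omega)
  show "am e s = omega l1 l3 \<nu>" by (simp add: s_def am_elliptic_F e_less_1)
  show "0 < s" "s < elliptic_K e"
    using range strict_monoD[OF elliptic_F_strict_mono[OF e_less_1]] elliptic_F_0[OF e_less_1]
    by (metis s_def, metis s_def elliptic_K_def)
  show "a * (cos (omega l1 l3 \<nu>))\<^sup>2 = c"
    using m apos by (simp add: cos_squared_eq sin) (simp add: m_def a_def c_def field_simps)
  show "a * (Delta e (omega l1 l3 \<nu>))\<^sup>2 = b"
  proof -
    have "e\<^sup>2 * m = (l1 - l2) * \<nu>$2 / a"
      using order by (simp add: e_square m_def)
    then have "a * (1 - e\<^sup>2 * m) = b"
      using apos by (simp add: right_diff_distrib) (simp add: a_def b_def algebra_simps)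
    then show ?thesis using m by (simp add: Delta_square e_less_1 sin)
  qed
qed

definition \<sigma> where "\<sigma> t = (am e (t + s) + am e (t - s)) / 2"
definition \<delta> where "\<delta> t = (am e (t + s) - am e (t - s)) / 2"

lemma sigma_delta: "am e (t - s) = \<sigma> t - \<delta> t" "am e (t + s) = \<sigma> t + \<delta> t"
  by (simp_all add: \<sigma>_def \<delta>_def field_simps)

text \<open>The chords joining \<open>am (t - s)\<close> to \<open>am (t + s)\<close> are tangent to the ellipse.\<close>

lemma chord_family:
  "0 < \<delta> t" "\<delta> t < pi / 2"
  "a * b * (cos (\<delta> t))\<^sup>2 = c * (b * (cos (\<sigma> t))\<^sup>2 + a * (sin (\<sigma> t))\<^sup>2)"
proof -
  note add = euler_addition[OF e_less_1 omega_facts(2,3), of t, folded \<sigma>_def \<delta>_def]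
  show "0 < \<delta> t" "\<delta> t < pi / 2" using add by simp_all
  let ?\<omega> = "omega l1 l3 \<nu>"
  have apos: "0 < a" and bpos: "0 < b" using abc by simp_all
  have C: "(cos ?\<omega>)\<^sup>2 = c / a" and D: "(Delta e ?\<omega>)\<^sup>2 = b / a"
    using omega_facts(4,5) apos by (auto simp: field_simps)
  show "a * b * (cos (\<delta> t))\<^sup>2 = c * (b * (cos (\<sigma> t))\<^sup>2 + a * (sin (\<sigma> t))\<^sup>2)"
  proof -
    have "a * b * (c / a * (x + y / (b / a))) = c * (b * x + a * y)" for x y
      using apos bpos by (simp add: field_simps)
    then show ?thesis using add(3) unfolding omega_facts(1) C D by metis
  qed
qed

text \<open>Every chord with the tangency relation and \<open>\<delta> < pi / 2\<close> belongs to the family: \<open>\<sigma>\<close> takes every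
real value by the intermediate value theorem, and \<open>\<delta>\<close> is determined by \<open>\<sigma>\<close>. This yields the
uniqueness of the Poncelet image without a direct study of the tangency equation.\<close>

lemma chord_family_complete:
  assumes \<delta>: "0 < d" "d < pi / 2"
    and rel: "a * b * (cos d)\<^sup>2 = c * (b * (cos x)\<^sup>2 + a * (sin x)\<^sup>2)"
  obtains t where "\<sigma> t = x" "\<delta> t = d"
proof -
  note [simp] = am_elliptic_F[OF e_less_1]
  have "continuous_on S \<sigma>" for S
    unfolding \<sigma>_def[abs_def]
    by (intro continuous_intros continuous_on_compose2[OF am_continuous[OF e_less_1, of UNIV]]) auto
  moreover have "\<sigma> (elliptic_F x e - s) \<le> x"
    using chord_family(1)[of "elliptic_F x e - s"] sigma_delta(2)[of "elliptic_F x e - s"] by simp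
  moreover have "x \<le> \<sigma> (elliptic_F x e + s)"
    using chord_family(1)[of "elliptic_F x e + s"] sigma_delta(1)[of "elliptic_F x e + s"] by simp
  ultimately obtain t where t: "\<sigma> t = x"
    using IVT'[of \<sigma> "elliptic_F x e - s" x "elliptic_F x e + s"] omega_facts(2) by auto
  have "a * b * (cos (\<delta> t))\<^sup>2 = a * b * (cos d)\<^sup>2"
    using chord_family(3)[of t] rel by (simp add: t)
  then have "(cos (\<delta> t))\<^sup>2 = (cos d)\<^sup>2" using abc by simp
  moreover have "0 < cos (\<delta> t)" "0 < cos d"
    using chord_family[of t] \<delta> by (auto intro!: cos_gt_zero)
  ultimately have "cos (\<delta> t) = cos d" by (simp add: power2_eq_iff)
  then have "\<delta> t = d"
    using chord_family[of t] \<delta> cos_inj_pi[of "\<delta> t" d] by simp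
  with t that show thesis by blast
qed

lemma poncelet_pt: "poncelet C1 C2 \<nu> (pt (am e (t - s))) = pt (am e (t + s))"
  unfolding poncelet_def
proof (rule the_equality)
  have "\<delta> t < pi" "0 < cos (\<delta> t)"
    using chord_family[of t] by (auto intro!: cos_gt_zero)
  then show "pt (am e (t + s)) \<in> conic_curve C1 \<and>
    segment_tangent (pencil C1 C2 \<nu>) (pt (am e (t - s))) (pt (am e (t + s))) \<and>
    lies_left (conic_curve (pencil C1 C2 \<nu>)) (pt (am e (t - s))) (pt (am e (t + s)))"
    using chord_family[of t] unfolding sigma_delta
    by (simp add: conic_curve_C1 segment_tangent_pt lies_left_pt)
next
  fix z assume z: "z \<in> conic_curve C1 \<and>
    segment_tangent (pencil C1 C2 \<nu>) (pt (am e (t - s))) z \<and>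
    lies_left (conic_curve (pencil C1 C2 \<nu>)) (pt (am e (t - s))) z"
  define x where "x = am e (t - s)"
  (* Among the angles of z, the one within the turn after x makes the half-difference lie in (0, pi). *)
  obtain y where y: "z = pt y" "x < y" "y < x + 2 * pi"
  proof -
    obtain y' where y': "z = pt y'" "x \<le> y'" "y' < x + 2 * pi"
      using z conic_curve_C1 pt_fundamental by blast
    moreover have "z \<noteq> pt x"
      using z by (auto simp: segment_tangent_def x_def)
    ultimately have "x \<noteq> y'" by auto
    then show thesis using that y' by auto
  qed
  define d where "d = (y - x) / 2"
  define m where "m = (x + y) / 2"
  have xy: "x = m - d" "y = m + d" by (simp_all add: d_def m_def field_simps)
  have d: "0 < d" "d < pi" using y by (auto simp: d_def)
  have rel: "a * b * (cos d)\<^sup>2 = c * (b * (cos m)\<^sup>2 + a * (sin m)\<^sup>2)"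
    using z segment_tangent_pt[OF d, of m] by (simp add: y xy flip: x_def)
  then have "0 < cos d"
    using z lies_left_pt[OF d rel] by (simp add: y xy flip: x_def)
  then have "d < pi / 2"
    using d cos_monotone_0_pi_le[of "pi / 2" d] by (cases "d < pi / 2") auto
  then obtain t' where t': "\<sigma> t' = m" "\<delta> t' = d"
    using chord_family_complete[OF d(1) _ rel] by blast
  have "am e (t' - s) = am e (t - s)"
    unfolding sigma_delta(1)[of t'] t' using xy by (simp add: x_def)
  then have "t' = t"
    using am_less_iff[OF e_less_1, of "t' - s" "t - s"] am_less_iff[OF e_less_1, of "t - s" "t' - s"]
    by linarith
  then show "z = pt (am e (t + s))"
    using t' by (simp add: y xy sigma_delta(2))
qed

end

section \<open>Parametrizations of a circle and rotation numbers\<close>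

lemma ccw_param_add_int:
  assumes "ccw_param S p" shows "p (t + of_int n) = p t"
proof -
  have 1: "p (t + 1) = p t" for t using assms by (simp add: ccw_param_def)
  have nat: "p (t + real k) = p t" for t k
  proof (induction k)
    case (Suc k)
    then show ?case using 1[of "t + real k"] by (simp add: ac_simps)
  qed simp
  show ?thesis
  proof (cases "0 \<le> n")
    case True
    then show ?thesis using nat[of t "nat n"] by simp
  next
    case False
    then show ?thesis using nat[of "t + of_int n" "nat (- n)"] by simp
  qed
qed

lemma ccw_param_eq_iff:
  assumes "ccw_param S p" shows "p x = p y \<longleftrightarrow> x - y \<in> \<int>"
proof
  assume eq: "p x = p y"
  have "p (frac t) = p t" for t
    using ccw_param_add_int[OF assms, of "frac t" "\<lfloor>t\<rfloor>"] by (simp add: frac_def)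
  with eq have "p (frac x) = p (frac y)" by simp
  moreover have "inj_on p {0..<1}" using assms by (simp add: ccw_param_def)
  ultimately have "frac x = frac y"
    by (rule_tac inj_onD[of p "{0..<1}"]) (auto simp: frac_lt_1)
  then have "x - y = of_int (\<lfloor>x\<rfloor> - \<lfloor>y\<rfloor>)" by (simp add: frac_def)
  then show "x - y \<in> \<int>" by (metis Ints_of_int)
next
  assume "x - y \<in> \<int>"
  then obtain n where "x - y = of_int n" by (auto elim: Ints_cases)
  then have "x = y + of_int n" by simp
  then show "p x = p y" using ccw_param_add_int[OF assms] by simp
qed

lemma ccw_param_fundamental:
  assumes "ccw_param S p" "z \<in> S"
  shows "\<exists>y. c \<le> y \<and> y < c + 1 \<and> p y = z"
proof -
  obtain x where x: "p x = z" using assms by (auto simp: ccw_param_def)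
  define y where "y = x + of_int (- \<lfloor>x - c\<rfloor>)"
  have "c \<le> y" "y < c + 1" unfolding y_def by linarith+
  moreover have "p y = z" unfolding y_def x[symmetric] by (rule ccw_param_add_int[OF assms(1)])
  ultimately show ?thesis by blast
qed

text \<open>Two counterclockwise parametrizations differ by an increasing homeomorphism commuting with the
unit translation. The matching of parameters is made turn by turn. Monotonicity within one turn
comes from the orientation clause: if \<open>h\<close> exchanged two parameters, the same triangle would have
both orientations. Continuity is then automatic, since an increasing surjection has no jumps.\<close>

lemma ccw_param_change:
  assumes p: "ccw_param S p" and q: "ccw_param S q"
  obtains h where "strict_mono h" "surj h" "\<And>x. h (x + 1) = h x + 1" "\<And>x. q (h x) = p x"
proof -
  have orient_pos: "orient (f a) (f b) (f c) > 0"
    if "ccw_param S f" "a < b" "b < c" "c < a + 1" for f a b c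
    using that by (auto simp: ccw_param_def)
  have pS: "p x \<in> S" for x using p by (auto simp: ccw_param_def)
  have qS: "q x \<in> S" for x using q by (auto simp: ccw_param_def)
  obtain c where c: "q c = p 0"
    using ccw_param_fundamental[OF q pS[of 0]] by blast
  define g where "g z = (SOME y. c \<le> y \<and> y < c + 1 \<and> q y = z)" for z
  have g: "c \<le> g z \<and> g z < c + 1 \<and> q (g z) = z" if "z \<in> S" for z
    unfolding g_def by (rule someI_ex) (rule ccw_param_fundamental[OF q that])
  define h where "h x = g (p x) + of_int \<lfloor>x\<rfloor>" for x
  have qh: "q (h x) = p x" for x
    using g[OF pS] ccw_param_add_int[OF q] by (simp add: h_def)
  have h_int: "h (x + of_int n) = h x + of_int n" for x n
    using ccw_param_add_int[OF p] by (simp add: h_def)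
  have range: "c + of_int \<lfloor>x\<rfloor> \<le> h x" "h x < c + of_int \<lfloor>x\<rfloor> + 1" for x
    using g[OF pS, of x] by (auto simp: h_def)
  have mono: "h x < h y" if "x < y" for x y
  proof (cases "\<lfloor>x\<rfloor> = \<lfloor>y\<rfloor>")
    case False
    then have "\<lfloor>x\<rfloor> + 1 \<le> \<lfloor>y\<rfloor>" using that by linarith
    then have "(of_int \<lfloor>x\<rfloor> + 1 :: real) \<le> of_int \<lfloor>y\<rfloor>" by linarith
    then show ?thesis using range[of x] range[of y] by linarith
  next
    case True
    define n where "n = (of_int \<lfloor>x\<rfloor> :: real)"
    define d where "d = c + n"
    have n: "n \<le> x" "y < n + 1" using True unfolding n_def by linarith+
    have hx: "d \<le> h x" "h x < d + 1" and hy: "d \<le> h y" "h y < d + 1"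
      using range[of x] range[of y] True by (auto simp: d_def n_def)
    have qd: "q d = p n"
      using c ccw_param_add_int[OF q, of c "\<lfloor>x\<rfloor>"] ccw_param_add_int[OF p, of 0 "\<lfloor>x\<rfloor>"]
      by (simp add: d_def n_def)
    have apart: "p u \<noteq> p v" if "u < v" "v < u + 1" for u v
    proof
      assume "p u = p v"
      then have "v - u \<in> \<int>" using ccw_param_eq_iff[OF p, of v u] by simp
      moreover have "0 < v - u" "v - u < 1" using that by auto
      ultimately show False using Ints_nonzero_abs_less1 by fastforce
    qed
    have ne: "h y \<noteq> d" using apart[of n y] qh[of y] qd n \<open>x < y\<close> by auto
    show ?thesis
    proof (cases "x = n")
      case True
      have "h x = d"
      proof (rule ccontr)
        assume "h x \<noteq> d"
        then have d: "d < h x" using hx by simp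
        have "h x - d \<in> \<int>" using ccw_param_eq_iff[OF q, of "h x" d] qh[of x] qd True by simp
        moreover have "0 < h x - d" "h x - d < 1" using d hx by auto
        ultimately show False using Ints_nonzero_abs_less1 by fastforce
      qed
      then show ?thesis using hy ne by simp
    next
      case False
      then have x: "n < x" using n by simp
      have "h x \<noteq> d" using apart[of n x] qh[of x] qd n x \<open>x < y\<close> by auto
      with hx hy ne have d: "d < h x" "d < h y" by auto
      have pos: "orient (q d) (q (h x)) (q (h y)) > 0"
        using orient_pos[OF p x \<open>x < y\<close>] n unfolding qh qd by simp
      show ?thesis
      proof (rule ccontr)
        assume "\<not> h x < h y"
        moreover have "h x \<noteq> h y" using apart[of x y] qh[of x] qh[of y] \<open>x < y\<close> n by auto
        ultimately have "orient (q d) (q (h y)) (q (h x)) > 0"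
          using orient_pos[OF q d(2), of "h x"] hx by auto
        with pos show False by (simp add: orient_def algebra_simps)
      qed
    qed
  qed
  have "surj h"
  proof (rule surjI)
    fix y
    obtain x where x: "p x = q y" using ccw_param_fundamental[OF p qS[of y]] by blast
    then obtain n where "y - h x = of_int n"
      using ccw_param_eq_iff[OF q, of y "h x"] qh[of x] by (auto elim: Ints_cases)
    then have "\<exists>x. h x = y" using h_int[of x n] by (intro exI[of _ "x + of_int n"]) simp
    then show "h (SOME x. h x = y) = y" by (rule someI_ex)
  qed
  moreover have "strict_mono h" using mono by (rule strict_monoI)
  moreover have "h (x + 1) = h x + 1" for x using h_int[of x 1] by simp
  ultimately show thesis using that qh by blast
qed

lemma strict_mono_surj_continuous:
  fixes h :: "real \<Rightarrow> real"
  assumes "strict_mono h" "surj h" shows "continuous_on A h"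
proof -
  have "continuous_on UNIV h"
    using assms by (intro continuous_onI_mono) (auto simp: strict_mono_less_eq)
  then show ?thesis by (rule continuous_on_subset) simp
qed

text \<open>The rotation number does not depend on the parametrization. If \<open>f\<close> is the translation by \<open>r\<close> in the
parameter \<open>q\<close>, then any lift with respect to any other parameter is conjugated by the change of
parameter \<open>h\<close> to a translation by \<open>r + m\<close>: the difference \<open>m\<close> is a continuous integer-valued
function. As \<open>h y - y\<close> is bounded, the conjugation does not alter the mean displacement.\<close>

lemma rotation_number_of_shift:
  assumes q: "ccw_param S q" and f: "\<And>t. f (q t) = q (t + r)"
  shows "has_rotation_number S f r"
  unfolding has_rotation_number_def
proof (intro conjI allI impI)
  show "\<exists>p. ccw_param S p" using q by blast
next
  fix p assume p: "ccw_param S p"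
  obtain h where h: "strict_mono h" "surj h" "\<And>x. h (x + 1) = h x + 1" "\<And>x. q (h x) = p x"
    using ccw_param_change[OF p q] by metis
  define G where "G x = inv h (h x + r)" for x
  have hG: "h (G x) = h x + r" for x
    unfolding G_def by (rule surj_f_inv_f[OF h(2)])
  have h_less: "h x < h y \<longleftrightarrow> x < y" and h_eq: "h x = h y \<longleftrightarrow> x = y" for x y
    using h(1) by (simp_all add: strict_mono_less strict_mono_eq)
  have "strict_mono G"
    by (rule strict_monoI) (simp add: hG h_less flip: h_less[of "G _" "G _"])
  moreover have "surj G"
  proof (rule surjI)
    fix y
    have "h (G (inv h (h y - r))) = h y" by (simp add: hG surj_f_inv_f[OF h(2)])
    then show "G (inv h (h y - r)) = y" by (simp add: h_eq)
  qed
  ultimately have "continuous_on UNIV G" by (rule strict_mono_surj_continuous)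
  moreover have "G (x + 1) = G x + 1" for x
  proof -
    have "h (G (x + 1)) = h (G x + 1)" by (simp add: h(3) hG)
    then show ?thesis by (simp only: h_eq)
  qed
  moreover have "p (G x) = f (p x)" for x
    by (metis h(4) hG f)
  ultimately have "circle_lift p f G"
    using \<open>strict_mono G\<close> by (simp add: circle_lift_def)
  then show "\<exists>G. circle_lift p f G" by blast
next
  fix p G assume p: "ccw_param S p" and G: "circle_lift p f G"
  obtain h where h: "strict_mono h" "surj h" "\<And>x. h (x + 1) = h x + 1" "\<And>x. q (h x) = p x"
    using ccw_param_change[OF p q] by metis
  define D where "D x = h (G x) - h x - r" for x
  have D_int: "D x \<in> \<int>" for x
  proof -
    have "q (h (G x)) = q (h x + r)"
      using G unfolding circle_lift_def by (metis h(4) f)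
    then show ?thesis
      using ccw_param_eq_iff[OF q, of "h (G x)" "h x + r"] by (simp add: D_def algebra_simps)
  qed
  have hc: "continuous_on A h" for A by (rule strict_mono_surj_continuous[OF h(1,2)])
  have Gc: "continuous_on UNIV G" using G by (simp add: circle_lift_def)
  have "continuous_on UNIV D"
    unfolding D_def[abs_def]
    by (intro continuous_intros hc continuous_on_compose2[OF hc[of UNIV] Gc]) simp
  then have "D constant_on UNIV"
  proof (rule continuous_discrete_range_constant[OF connected_UNIV])
    fix x :: real
    have "1 \<le> norm (D y - D x)" if "D y \<noteq> D x" for y
      using that D_int Ints_nonzero_abs_ge1[of "D y - D x"] by simp
    then show "\<exists>e>0. \<forall>y. y \<in> UNIV \<and> D y \<noteq> D x \<longrightarrow> e \<le> norm (D y - D x)"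
      by (intro exI[of _ 1]) simp
  qed
  then obtain m where m: "\<And>x. D x = m" by (auto simp: constant_on_def)
  then have m_int: "m \<in> \<int>" using D_int by metis
  have iter: "h ((G ^^ n) x) = h x + real n * (r + m)" for n x
  proof (induction n)
    case (Suc n)
    then show ?case using m[of "(G ^^ n) x"] by (simp add: D_def algebra_simps)
  qed simp
  have h_int: "h (of_int n) = h 0 + of_int n" for n
  proof -
    have nat: "h (x + real k) = h x + real k" for x k
    proof (induction k)
      case (Suc k)
      then show ?case using h(3)[of "x + real k"] by (simp add: ac_simps)
    qed simp
    show ?thesis
    proof (cases "0 \<le> n")
      case True
      then show ?thesis using nat[of 0 "nat n"] by simp
    next
      case False
      then show ?thesis using nat[of "of_int n" "nat (- n)"] by simp
    qed
  qed
  have near: "\<bar>h y - y - h 0\<bar> \<le> 1" for y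
  proof -
    have "h (of_int \<lfloor>y\<rfloor>) \<le> h y" "h y \<le> h (of_int (\<lfloor>y\<rfloor> + 1))"
      using strict_mono_less_eq[OF h(1)] by simp_all
    then show ?thesis unfolding h_int by simp linarith
  qed
  have "(\<lambda>n. ((G ^^ n) x - x) / real n) \<longlonglongrightarrow> r + m" for x
  proof (rule LIM_zero_cancel)
    show "(\<lambda>n. ((G ^^ n) x - x) / real n - (r + m)) \<longlonglongrightarrow> 0"
    proof (rule Lim_null_comparison)
      show "(\<lambda>n. 2 / real n) \<longlonglongrightarrow> 0" by (rule lim_const_over_n)
      have "norm (((G ^^ n) x - x) / real n - (r + m)) \<le> 2 / real n" if "0 < n" for n
      proof -
        have "\<bar>(G ^^ n) x - x - real n * (r + m)\<bar> \<le> 2"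
          using iter[of n x] near[of x] near[of "(G ^^ n) x"] by linarith
        moreover have "((G ^^ n) x - x) / real n - (r + m)
            = ((G ^^ n) x - x - real n * (r + m)) / real n"
          using that by (simp add: field_simps)
        ultimately show ?thesis using that by (simp add: divide_right_mono)
      qed
      then show "\<forall>\<^sub>F n in sequentially. norm (((G ^^ n) x - x) / real n - (r + m)) \<le> 2 / real n"
        by (auto simp: eventually_sequentially intro!: exI[of _ 1])
    qed
  qed
  then show "\<exists>m\<in>\<int>. \<forall>x. (\<lambda>n. ((G ^^ n) x - x) / real n) \<longlonglongrightarrow> r + m"
    using m_int by blast
qed

lemma int_iterate_shift:
  assumes q: "ccw_param S q" and f: "\<And>t. f (q t) = q (t + r)"
  shows "int_iterate S f k (q t) = q (t + of_int k * r)"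
proof -
  have S: "S = range q" using q by (simp add: ccw_param_def)
  have iter: "(g ^^ n) (q t) = q (t + real n * a)"
    if "\<And>t. g (q t) = q (t + a)" for g a n
    by (induction n) (simp_all add: that algebra_simps)
  have "inj_on f S"
    unfolding S by (auto simp: inj_on_def f ccw_param_eq_iff[OF q])
  then have "inv_into S f (q t) = q (t + - r)" for t
    using S f[of "t - r"] by (intro inv_into_f_eq) auto
  from iter[of "inv_into S f" "- r", OF this] iter[of f r, OF f] show ?thesis
    by (simp add: int_iterate_def)
qed

section \<open>Simultaneous diagonalization\<close>

lemma form_symmetric:
  fixes C :: "real^'n^'n"
  assumes "transpose C = C" shows "x \<bullet> (C *v y) = y \<bullet> (C *v x)"
  by (metis assms dot_lmul_matrix inner_commute transpose_matrix_vector)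

lemma form_pos_at_infinity:
  fixes C :: "real^3^3"
  assumes pd: "pos_definite (upper_left_block C)" and u: "u \<noteq> 0" "u$3 = 0"
  shows "0 < u \<bullet> (C *v u)"
proof -
  define x :: "real^2" where "x = vector [u$1, u$2]"
  have "x \<noteq> 0" using u by (auto simp: x_def vec_eq_iff forall_3 forall_2)
  then have "0 < x \<bullet> (upper_left_block C *v x)" using pd by (simp add: pos_definite_def)
  also have "\<dots> = u \<bullet> (C *v u)"
    using u by (simp add: x_def upper_left_block_def inner_vec_def matrix_vector_mult_def sum_2 sum_3)
  finally show ?thesis .
qed

lemma eigenvectors_independent:
  fixes A :: "real^'n^'n"
  assumes eig: "A *v v1 = l1 *\<^sub>R v1" "A *v v2 = l2 *\<^sub>R v2" "A *v v3 = l3 *\<^sub>R v3"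
    and nz: "v1 \<noteq> 0" "v2 \<noteq> 0" "v3 \<noteq> 0" and dist: "l1 \<noteq> l2" "l1 \<noteq> l3" "l2 \<noteq> l3"
    and z: "x1 *\<^sub>R v1 + x2 *\<^sub>R v2 + x3 *\<^sub>R v3 = 0"
  shows "x1 = 0 \<and> x2 = 0 \<and> x3 = 0"
proof -
  have "A *v (x1 *\<^sub>R v1 + x2 *\<^sub>R v2 + x3 *\<^sub>R v3)
      = x1 *\<^sub>R (l1 *\<^sub>R v1) + x2 *\<^sub>R (l2 *\<^sub>R v2) + x3 *\<^sub>R (l3 *\<^sub>R v3)"
    by (simp only: matrix_vector_right_distrib matrix_vector_mult_scaleR eig)
  then have z': "x1 *\<^sub>R (l1 *\<^sub>R v1) + x2 *\<^sub>R (l2 *\<^sub>R v2) + x3 *\<^sub>R (l3 *\<^sub>R v3) = 0"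
    using z by simp
  have a: "(x1 * (l1 - l3)) *\<^sub>R v1 + (x2 * (l2 - l3)) *\<^sub>R v2 = 0"
  proof -
    have "(x1 * (l1 - l3)) *\<^sub>R v1 + (x2 * (l2 - l3)) *\<^sub>R v2 =
      (x1 *\<^sub>R (l1 *\<^sub>R v1) + x2 *\<^sub>R (l2 *\<^sub>R v2) + x3 *\<^sub>R (l3 *\<^sub>R v3))
       - l3 *\<^sub>R (x1 *\<^sub>R v1 + x2 *\<^sub>R v2 + x3 *\<^sub>R v3)"
      by (simp add: algebra_simps)
    then show ?thesis unfolding z z' by simp
  qed
  have "A *v ((x1 * (l1 - l3)) *\<^sub>R v1 + (x2 * (l2 - l3)) *\<^sub>R v2)
      = (x1 * (l1 - l3)) *\<^sub>R (l1 *\<^sub>R v1) + (x2 * (l2 - l3)) *\<^sub>R (l2 *\<^sub>R v2)"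
    by (simp only: matrix_vector_right_distrib matrix_vector_mult_scaleR eig)
  then have a': "(x1 * (l1 - l3)) *\<^sub>R (l1 *\<^sub>R v1) + (x2 * (l2 - l3)) *\<^sub>R (l2 *\<^sub>R v2) = 0"
    using a by simp
  have "(x1 * (l1 - l3) * (l1 - l2)) *\<^sub>R v1 =
     ((x1 * (l1 - l3)) *\<^sub>R (l1 *\<^sub>R v1) + (x2 * (l2 - l3)) *\<^sub>R (l2 *\<^sub>R v2))
      - l2 *\<^sub>R ((x1 * (l1 - l3)) *\<^sub>R v1 + (x2 * (l2 - l3)) *\<^sub>R v2)"
    by (simp add: algebra_simps)
  then have "(x1 * (l1 - l3) * (l1 - l2)) *\<^sub>R v1 = 0" unfolding a a' by simp
  then have 1: "x1 = 0" using nz dist by simp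
  then have 2: "x2 = 0" using a nz dist by simp
  then show ?thesis using 1 z nz by simp
qed

text \<open>If the form \<open>C1\<close> is negative on an eigenvector \<open>v\<close> and positive on an eigenvector \<open>w\<close>, then their
plane contains a vector isotropic for \<open>C2\<close>, on which \<open>C1\<close> takes the value \<open>1 / lw - 1 / lv\<close>. The
inner conic being inside the outer one makes this value negative. So the timelike eigenvector of
the pencil belongs to the smallest eigenvalue.\<close>

lemma negative_direction_is_smallest:
  fixes C1 C2 :: "real^'n^'n"
  assumes inside: "\<And>u. u \<noteq> 0 \<Longrightarrow> u \<bullet> (C2 *v u) = 0 \<Longrightarrow> u \<bullet> (C1 *v u) < 0"
    and form1: "\<And>x y. (x *\<^sub>R v + y *\<^sub>R w) \<bullet> (C1 *v (x *\<^sub>R v + y *\<^sub>R w)) = dv * x\<^sup>2 + dw * y\<^sup>2"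
    and form2: "\<And>x y. (x *\<^sub>R v + y *\<^sub>R w) \<bullet> (C2 *v (x *\<^sub>R v + y *\<^sub>R w)) = lv * dv * x\<^sup>2 + lw * dw * y\<^sup>2"
    and d: "dv < 0" "0 < dw" and l: "0 < lv" "0 < lw"
  shows "lv \<le> lw"
proof (rule ccontr)
  assume "\<not> lv \<le> lw"
  then have less: "lw < lv" by simp
  define x y where "x = 1 / sqrt (lv * - dv)" and "y = 1 / sqrt (lw * dw)"
  define u where "u = x *\<^sub>R v + y *\<^sub>R w"
  have "0 < lv * - dv" using d l by (intro mult_pos_pos) auto
  then have x: "x\<^sup>2 = 1 / (lv * - dv)" by (simp add: x_def power_divide del: mult_minus_right)
  have y: "y\<^sup>2 = 1 / (lw * dw)" using d l by (simp add: y_def power_divide)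
  have "u \<bullet> (C2 *v u) = 0"
    unfolding u_def form2 x y using d l by simp
  moreover have "u \<bullet> (C1 *v u) = 1 / lw - 1 / lv"
    unfolding u_def form1 x y using d l by (simp add: field_simps)
  moreover have "1 / lw - 1 / lv > 0" using less l by (simp add: field_simps)
  ultimately show False using inside[of u] by (cases "u = 0") auto
qed

lemma matrix_of_columns_mult:
  fixes v1 v2 v3 x :: "real^3"
  shows "transpose (vector [v1, v2, v3]) *v x = x$1 *\<^sub>R v1 + x$2 *\<^sub>R v2 + x$3 *\<^sub>R v3"
  by (simp add: vec_eq_iff matrix_vector_mult_def transpose_def sum_3 mult.commute)

text \<open>A matrix that diagonalizes both forms can be turned into a frame by sign changes of its columns,
which leave the diagonal forms unchanged. The last coordinate cannot vanish on the cone over the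
closed disc, because \<open>C1\<close> is nonpositive on the cone and positive at the points at infinity; the
cone being convex, the last coordinate has a constant sign there. Negating \<open>M\<close> makes this sign
positive, and negating the first column then makes the determinant positive.\<close>

lemma circle_frame_of_forms:
  fixes M C1 C2 :: "real^3^3"
  assumes det: "det M \<noteq> 0" and pd: "pos_definite (upper_left_block C1)"
    and form1: "\<And>x y. (M *v x) \<bullet> (C1 *v (M *v y)) = x$1 * y$1 + x$2 * y$2 - x$3 * y$3"
    and form2: "\<And>x y. (M *v x) \<bullet> (C2 *v (M *v y))
      = l1 * (x$1 * y$1) + l2 * (x$2 * y$2) - l3 * (x$3 * y$3)"
    and order: "l2 < l1" "l3 < l2" "0 < l3"
  shows "\<exists>M'. circle_frame M' C1 C2 l1 l2 l3"
proof -
  have inj: "M *v x = 0 \<Longrightarrow> x = 0" for x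
    using det by (metis invertible_det_nz invertible_left_inverse matrix_left_invertible_ker)
  have nz: "(M *v x) $ 3 \<noteq> 0" if "(x$1)\<^sup>2 + (x$2)\<^sup>2 \<le> (x$3)\<^sup>2" "0 < x$3" for x
  proof
    assume "(M *v x) $ 3 = 0"
    moreover have "x \<noteq> 0" using that by auto
    ultimately have "0 < (M *v x) \<bullet> (C1 *v (M *v x))"
      using inj by (intro form_pos_at_infinity[OF pd]) auto
    with that show False by (simp add: form1 power2_eq_square)
  qed
  define z :: "real^3" where "z = vector [0, 0, 1]"
  define t where "t = (M *v z) $ 3"
  have "t \<noteq> 0" unfolding t_def by (rule nz) (simp_all add: z_def)
  have same: "0 < t * (M *v x) $ 3" if x: "(x$1)\<^sup>2 + (x$2)\<^sup>2 \<le> (x$3)\<^sup>2" "0 < x$3" for x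
  proof (rule ccontr)
    assume neg: "\<not> ?thesis"
    define r where "r = (M *v x) $ 3"
    define y where "y = \<bar>r\<bar> *\<^sub>R z + \<bar>t\<bar> *\<^sub>R x"
    have "t * r < 0" using neg nz[OF x] \<open>t \<noteq> 0\<close> by (simp add: r_def less_le)
    then have "\<bar>r\<bar> * t + \<bar>t\<bar> * r = 0" by (auto simp: mult_less_0_iff)
    then have "(M *v y) $ 3 = 0"
      by (simp add: y_def matrix_vector_right_distrib matrix_vector_mult_scaleR r_def t_def)
    moreover have "0 < y $ 3" using x \<open>t \<noteq> 0\<close> by (simp add: y_def z_def add_nonneg_pos)
    moreover have "(y$1)\<^sup>2 + (y$2)\<^sup>2 \<le> (y$3)\<^sup>2"
    proof -
      have "(y$1)\<^sup>2 + (y$2)\<^sup>2 = t\<^sup>2 * ((x$1)\<^sup>2 + (x$2)\<^sup>2)"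
        by (simp add: y_def z_def power_mult_distrib algebra_simps)
      also have "\<dots> \<le> t\<^sup>2 * (x$3)\<^sup>2" using x by (intro mult_left_mono) auto
      also have "\<dots> = (\<bar>t\<bar> * x$3)\<^sup>2" by (simp add: power_mult_distrib)
      also have "\<dots> \<le> (y$3)\<^sup>2" using x by (intro power_mono) (auto simp: y_def z_def)
      finally show ?thesis .
    qed
    ultimately show False using nz by blast
  qed
  define s :: real where "s = sgn t"
  define s' :: real where "s' = sgn (s * det M)"
  have s: "s * s = 1" "s \<noteq> 0" using \<open>t \<noteq> 0\<close> by (auto simp: s_def sgn_if)
  have s': "s' * s' = 1" "s' * (s * det M) > 0"
    using s det linorder_neqE_linordered_idom[of "s * det M" 0] by (auto simp: s'_def sgn_if)
  define flip :: "real^3 \<Rightarrow> real^3" where "flip x = vector [s * s' * x$1, s * x$2, s * x$3]" for x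
  define N :: "real^3^3" where "N = vector [vector [s * s', 0, 0], vector [0, s, 0], vector [0, 0, s]]"
  have N: "N *v x = flip x" for x
    by (simp add: N_def flip_def vec_eq_iff forall_3 matrix_vector_mult_def sum_3)
  have MN: "(M ** N) *v x = M *v flip x" for x
    by (simp add: N flip: matrix_vector_mul_assoc)
  have flip_mult: "flip x $ i * flip y $ i = x$i * y$i" for x y i
  proof -
    have "s * s' * a * (s * s' * b) = (s * s) * (s' * s') * (a * b)"
      "s * a * (s * b) = (s * s) * (a * b)" for a b
      by (simp_all add: mult_ac)
    then show ?thesis using exhaust_3[of i] s s' by (auto simp: flip_def)
  qed
  have "circle_frame (M ** N) C1 C2 l1 l2 l3"
  proof
    have "det N = (s * s) * (s' * s)" by (simp add: N_def det_3 mult_ac)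
    then have "det (M ** N) = s' * (s * det M)" using s by (simp add: det_mul mult_ac)
    then show "0 < det (M ** N)" using s' by simp
  next
    fix x :: "real^3" assume x: "(x$1)\<^sup>2 + (x$2)\<^sup>2 \<le> (x$3)\<^sup>2" "0 < x$3"
    have sq: "(flip x $ i)\<^sup>2 = (x $ i)\<^sup>2" for i
      using flip_mult[of x i x] by (simp add: power2_eq_square)
    have "0 < t * (M *v (s *\<^sub>R flip x)) $ 3"
    proof (rule same)
      show "((s *\<^sub>R flip x)$1)\<^sup>2 + ((s *\<^sub>R flip x)$2)\<^sup>2 \<le> ((s *\<^sub>R flip x)$3)\<^sup>2"
        using x s by (simp add: power_mult_distrib sq) (simp add: power2_eq_square)
      have "(s *\<^sub>R flip x) $ 3 = (s * s) * x$3" by (simp add: flip_def)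
      then show "0 < (s *\<^sub>R flip x) $ 3" using x s by simp
    qed
    then have "0 < (t * s) * (M *v flip x) $ 3" by (simp add: matrix_vector_mult_scaleR mult_ac)
    moreover have "t * s = \<bar>t\<bar>" by (simp add: s_def sgn_if)
    ultimately show "0 < ((M ** N) *v x) $ 3"
      using \<open>t \<noteq> 0\<close> by (simp add: MN zero_less_mult_iff)
  qed (simp_all add: MN form1 form2 flip_mult order)
  then show ?thesis by blast
qed

text \<open>The eigenvectors of \<open>C1\<^sup>-\<^sup>1 C2\<close> are orthogonal for both forms, since the eigenvalues are distinct.
The determinant shows that \<open>C1\<close> is negative on one or on three of them, positivity at the points at
infinity excludes three, and the exceptional one is that of \<open>l3\<close>. Scaling the eigenvectors
gives the columns of the frame.\<close>

lemma simultaneous_normal_form: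
  fixes C1 C2 :: "real^3^3"
  assumes sym: "transpose C1 = C1" "transpose C2 = C2"
    and pd: "pos_definite (upper_left_block C1)" and det: "det C1 < 0"
    and eig: "eigenvalues (matrix_inv C1 ** C2) = {l1, l2, l3}"
    and order: "l2 < l1" "l3 < l2" "0 < l3"
    and inside: "\<And>u. u \<noteq> 0 \<Longrightarrow> u \<bullet> (C2 *v u) = 0 \<Longrightarrow> u \<bullet> (C1 *v u) < 0"
  shows "\<exists>M. circle_frame M C1 C2 l1 l2 l3"
proof -
  define A where "A = matrix_inv C1 ** C2"
  have "invertible C1" using det by (simp add: invertible_det_nz)
  then have "C1 ** matrix_inv C1 = mat 1"
    unfolding invertible_def matrix_inv_def by (rule someI2_ex) blast
  then have "C1 ** A = C2" by (simp add: A_def matrix_mul_assoc)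
  then have A: "C1 *v (A *v v) = C2 *v v" for v
    by (simp add: matrix_vector_mul_assoc)
  obtain v1 v2 v3 where v: "v1 \<noteq> 0" "v2 \<noteq> 0" "v3 \<noteq> 0"
    and Av: "A *v v1 = l1 *\<^sub>R v1" "A *v v2 = l2 *\<^sub>R v2" "A *v v3 = l3 *\<^sub>R v3"
  proof -
    have "l1 \<in> eigenvalues A" "l2 \<in> eigenvalues A" "l3 \<in> eigenvalues A"
      using eig by (simp_all add: A_def)
    then show thesis using that by (auto simp: eigenvalues_def)
  qed
  have C2v: "C2 *v v1 = l1 *\<^sub>R (C1 *v v1)" "C2 *v v2 = l2 *\<^sub>R (C1 *v v2)" "C2 *v v3 = l3 *\<^sub>R (C1 *v v3)"
    using Av by (simp_all add: matrix_vector_mult_scaleR flip: A)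
  have ortho: "v \<bullet> (C1 *v w) = 0"
    if "C2 *v v = a *\<^sub>R (C1 *v v)" "C2 *v w = b *\<^sub>R (C1 *v w)" "a \<noteq> b" for v w a b
  proof -
    have "b * (v \<bullet> (C1 *v w)) = v \<bullet> (C2 *v w)" using that by simp
    also have "\<dots> = w \<bullet> (C2 *v v)" by (rule form_symmetric[OF sym(2)])
    also have "\<dots> = a * (v \<bullet> (C1 *v w))" using that form_symmetric[OF sym(1), of w v] by simp
    finally show ?thesis using that(3) by simp
  qed
  define V where "V = transpose (vector [v1, v2, v3] :: real^3^3)"
  have V: "V *v x = x$1 *\<^sub>R v1 + x$2 *\<^sub>R v2 + x$3 *\<^sub>R v3" for x
    unfolding V_def by (rule matrix_of_columns_mult)
  have detV: "det V \<noteq> 0"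
  proof -
    have "x = 0" if "V *v x = 0" for x
    proof -
      have "x$1 = 0 \<and> x$2 = 0 \<and> x$3 = 0"
        using eigenvectors_independent[OF Av v] that order by (auto simp: V)
      then show ?thesis by (simp add: vec_eq_iff forall_3)
    qed
    then have "\<exists>B. B ** V = mat 1" using matrix_left_invertible_ker by blast
    then show ?thesis by (metis invertible_det_nz invertible_left_inverse)
  qed
  define d1 d2 d3 where "d1 = v1 \<bullet> (C1 *v v1)" and "d2 = v2 \<bullet> (C1 *v v2)" and "d3 = v3 \<bullet> (C1 *v v3)"
  have orth: "v1 \<bullet> (C1 *v v2) = 0" "v1 \<bullet> (C1 *v v3) = 0" "v2 \<bullet> (C1 *v v3) = 0"
    "v2 \<bullet> (C1 *v v1) = 0" "v3 \<bullet> (C1 *v v1) = 0" "v3 \<bullet> (C1 *v v2) = 0"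
    using ortho[OF C2v(1,2)] ortho[OF C2v(1,3)] ortho[OF C2v(2,3)]
      ortho[OF C2v(2,1)] ortho[OF C2v(3,1)] ortho[OF C2v(3,2)] order by simp_all
  have form1: "(V *v x) \<bullet> (C1 *v (V *v y)) = d1 * (x$1 * y$1) + d2 * (x$2 * y$2) + d3 * (x$3 * y$3)" for x y
    by (simp add: V inner_simps matrix_vector_right_distrib matrix_vector_mult_scaleR orth
        d1_def d2_def d3_def algebra_simps)
  have form2: "(V *v x) \<bullet> (C2 *v (V *v y))
      = l1 * (d1 * (x$1 * y$1)) + l2 * (d2 * (x$2 * y$2)) + l3 * (d3 * (x$3 * y$3))" for x y
    by (simp add: V inner_simps matrix_vector_right_distrib matrix_vector_mult_scaleR C2v orth
        d1_def d2_def d3_def algebra_simps)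
  have prod: "d1 * d2 * d3 < 0"
  proof -
    have "(transpose V ** C1 ** V) $ i $ j = axis i 1 \<bullet> ((transpose V ** C1 ** V) *v axis j 1)" for i j
      by (simp add: matrix_vector_mul_component inner_axis_axis inner_axis' matrix_vector_mult_basis column_def)
    also have "u \<bullet> ((transpose V ** C1 ** V) *v w) = (V *v u) \<bullet> (C1 *v (V *v w))" for u w
    proof -
      have "u \<bullet> ((transpose V ** C1 ** V) *v w) = u \<bullet> (transpose V *v (C1 *v (V *v w)))"
        by (simp only: matrix_vector_mul_assoc matrix_mul_assoc)
      also have "\<dots> = (C1 *v (V *v w)) \<bullet> (V *v u)"
        by (simp add: inner_commute[of u] dot_lmul_matrix)
      finally show ?thesis by (simp only: inner_commute)
    qed
    finally have entry: "(transpose V ** C1 ** V) $ i $ j = (V *v axis i 1) \<bullet> (C1 *v (V *v axis j 1))" for i j .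
    have "det (transpose V ** C1 ** V) = d1 * d2 * d3"
      unfolding det_3 entry form1 by (simp add: axis_def)
    moreover have "det (transpose V ** C1 ** V) = (det V)\<^sup>2 * det C1"
      by (simp add: det_mul det_transpose power2_eq_square)
    moreover have "(det V)\<^sup>2 * det C1 < 0"
      using detV det by (simp add: mult_less_0_iff)
    ultimately show ?thesis by simp
  qed
  have one_pos: "0 < d1 \<or> 0 < d2 \<or> 0 < d3"
  proof (rule ccontr)
    assume neg: "\<not> ?thesis"
    have "surj ((*v) V)"
      using detV by (metis invertible_det_nz invertible_right_inverse matrix_right_invertible_surjective)
    then obtain x where x: "V *v x = axis 1 1" by (metis surjD)
    have "0 < (V *v x) \<bullet> (C1 *v (V *v x))"
      unfolding x by (intro form_pos_at_infinity[OF pd]) (auto simp: axis_def vec_eq_iff)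
    moreover have "(V *v x) \<bullet> (C1 *v (V *v x)) \<le> 0"
      unfolding form1 using neg by (auto intro!: add_nonpos_nonpos mult_nonpos_nonneg)
    ultimately show False by simp
  qed
  have small: False
    if "d < 0" "0 < e" "0 < b" "b < a" "v \<bullet> (C1 *v v) = d" "w \<bullet> (C1 *v w) = e"
       "C2 *v v = a *\<^sub>R (C1 *v v)" "C2 *v w = b *\<^sub>R (C1 *v w)" for d e a b v w
  proof -
    have o: "v \<bullet> (C1 *v w) = 0" "w \<bullet> (C1 *v v) = 0"
      using ortho[OF that(7,8)] ortho[OF that(8,7)] that by auto
    have "(x *\<^sub>R v + y *\<^sub>R w) \<bullet> (C1 *v (x *\<^sub>R v + y *\<^sub>R w)) = d * x\<^sup>2 + e * y\<^sup>2"
      "(x *\<^sub>R v + y *\<^sub>R w) \<bullet> (C2 *v (x *\<^sub>R v + y *\<^sub>R w)) = a * d * x\<^sup>2 + b * e * y\<^sup>2" for x y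
      using that o
      by (simp_all add: inner_simps matrix_vector_right_distrib matrix_vector_mult_scaleR power2_eq_square)
    then have "a \<le> b"
      using that inside by (intro negative_direction_is_smallest[of C2 C1 v w d e a b]) auto
    with that show False by simp
  qed
  have signs: "0 < d1" "0 < d2" "d3 < 0"
  proof -
    have n1: False if "d1 < 0" "0 < d3"
      using small[OF that order(3) _ _ _ C2v(1,3)] order by (simp add: d1_def d3_def)
    have n2: False if "d2 < 0" "0 < d3"
      using small[OF that order(3) _ _ _ C2v(2,3)] order by (simp add: d2_def d3_def)
    have nz: "d1 \<noteq> 0" "d2 \<noteq> 0" "d3 \<noteq> 0" using prod by auto
    show d3: "d3 < 0"
    proof (rule ccontr)
      assume "\<not> d3 < 0"
      then have "0 < d3" using nz by simp
      moreover from this have "0 < d1" "0 < d2"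
        using n1 n2 nz by (meson linorder_neqE_linordered_idom)+
      ultimately show False using prod by (simp add: mult_less_0_iff)
    qed
    with prod have "0 < d1 * d2" by (simp add: mult_less_0_iff)
    with one_pos d3 show "0 < d1" "0 < d2" by (auto simp only: zero_less_mult_iff)
  qed
  define N :: "real^3^3" where
    "N = vector [vector [1 / sqrt d1, 0, 0], vector [0, 1 / sqrt d2, 0], vector [0, 0, 1 / sqrt (- d3)]]"
  have N: "(N *v x) $ 1 = x$1 / sqrt d1" "(N *v x) $ 2 = x$2 / sqrt d2" "(N *v x) $ 3 = x$3 / sqrt (- d3)" for x
    by (simp_all add: N_def matrix_vector_mult_def sum_3)
  have MN: "(V ** N) *v x = V *v (N *v x)" for x
    by (simp add: matrix_vector_mul_assoc)
  show ?thesis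
  proof (rule circle_frame_of_forms[OF _ pd])
    have "det N \<noteq> 0" using signs by (simp add: N_def det_3)
    then show "det (V ** N) \<noteq> 0" using detV by (simp add: det_mul)
  qed (use signs in \<open>simp_all add: MN form1 form2 N order abs_of_pos abs_of_neg\<close>)
qed

section \<open>Poncelet maps as translations\<close>

context circle_frame
begin

abbreviation K where "K \<equiv> elliptic_K (modulus l1 l2 l3)"

text \<open>The parameter in which all Poncelet maps of the pencil are translations: time along the flow of
the amplitude, scaled such that a full turn takes time 1 instead of \<open>4 K\<close>.\<close>

definition elliptic_param :: "real \<Rightarrow> real^2" where
  "elliptic_param t = pt (am (modulus l1 l2 l3) (4 * K * t))"

lemma modulus_less_1: "(modulus l1 l2 l3)\<^sup>2 < 1"
  using order by (simp add: modulus_def)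

lemma K_pos: "0 < K"
  by (rule elliptic_K_pos[OF modulus_less_1])

lemma am_add_4K:
  "am (modulus l1 l2 l3) (4 * K * (t + 1)) = am (modulus l1 l2 l3) (4 * K * t) + 2 * pi"
  using am_add_2K[OF modulus_less_1, of "4 * K * t"]
    am_add_2K[OF modulus_less_1, of "4 * K * t + 2 * K"] by (simp add: algebra_simps)

lemma ccw_param_elliptic_param: "ccw_param (conic_curve C1) elliptic_param"
  unfolding ccw_param_def
proof (intro conjI allI impI)
  let ?am = "\<lambda>t. am (modulus l1 l2 l3) (4 * K * t)"
  have am_less: "?am s < ?am t \<longleftrightarrow> s < t" for s t
    using K_pos by (simp add: am_less_iff[OF modulus_less_1])
  show per: "elliptic_param (t + 1) = elliptic_param t" for t
    unfolding elliptic_param_def am_add_4K using pt_periodic[of _ 1] by simp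
  show "continuous_on UNIV elliptic_param"
    unfolding elliptic_param_def[abs_def]
    by (intro continuous_on_compose2[OF pt_continuous[of UNIV]]
        continuous_on_compose2[OF am_continuous[OF modulus_less_1, of UNIV]] continuous_intros) auto
  show "range elliptic_param = conic_curve C1"
  proof -
    have "pt \<theta> = elliptic_param (elliptic_F \<theta> (modulus l1 l2 l3) / (4 * K))" for \<theta>
      using K_pos by (simp add: elliptic_param_def am_elliptic_F[OF modulus_less_1])
    then have "range pt \<subseteq> range elliptic_param" by (metis image_subsetI rangeI)
    moreover have "range elliptic_param \<subseteq> range pt" by (auto simp: elliptic_param_def)
    ultimately show ?thesis unfolding conic_curve_C1 by blast
  qed
  show "0 < orient (elliptic_param a) (elliptic_param b) (elliptic_param c)"
    if "a < b \<and> b < c \<and> c < a + 1" for a b c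
  proof -
    have "?am c < ?am a + 2 * pi"
      using that am_less[of c "a + 1"] by (simp add: am_add_4K)
    then show ?thesis
      using that unfolding elliptic_param_def by (intro orient_pt_pos) (simp_all add: am_less)
  qed
  show "inj_on elliptic_param {0..<1}"
  proof (rule linorder_inj_onI)
    fix s t :: real assume st: "s < t" "s \<in> {0..<1}" "t \<in> {0..<1}"
    then have "?am t < ?am s + 2 * pi"
      using am_less[of t "s + 1"] by (simp add: am_add_4K)
    with st show "elliptic_param s \<noteq> elliptic_param t"
      unfolding elliptic_param_def by (intro pt_inj) (simp_all add: am_less)
  qed auto
qed

text \<open>In the unscaled time the Poncelet map advances by \<open>2 s = 2 F(\<omega>, e)\<close>; division by \<open>4 K\<close> gives
\<open>rho\<close>.\<close>

lemma poncelet_elliptic_param: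
  assumes "0 < \<nu>$2" "0 < \<nu>$1 + l3 * \<nu>$2"
  shows "poncelet C1 C2 \<nu> (elliptic_param t) = elliptic_param (t + rho l1 l2 l3 \<nu>)"
proof -
  interpret inner_conic M C1 C2 l1 l2 l3 \<nu> by unfold_locales (use assms in auto)
  have rho: "4 * K * rho l1 l2 l3 \<nu> = 2 * s"
    using K_pos by (simp add: rho_def s_def)
  have "4 * K * t + s + s = 4 * K * (t + rho l1 l2 l3 \<nu>)"
    using rho by (simp add: distrib_left)
  with poncelet_pt[of "4 * K * t + s"] show ?thesis
    by (simp add: elliptic_param_def)
qed

lemma poncelet_comp_elliptic_param:
  assumes "\<And>j. j \<in> {1..N} \<Longrightarrow> \<nu> j $ 2 > 0 \<and> \<nu> j $ 1 + l3 * \<nu> j $ 2 > 0"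
  shows "poncelet_comp C1 C2 \<nu> k N (elliptic_param t)
    = elliptic_param (t + (\<Sum>j=1..N. of_int (k j) * rho l1 l2 l3 (\<nu> j)))"
  using assms
proof (induction N)
  case (Suc N)
  have "poncelet C1 C2 (\<nu> (Suc N)) (elliptic_param u)
      = elliptic_param (u + rho l1 l2 l3 (\<nu> (Suc N)))" for u
    using Suc.prems[of "Suc N"] by (intro poncelet_elliptic_param) auto
  from int_iterate_shift[OF ccw_param_elliptic_param, of "poncelet C1 C2 (\<nu> (Suc N))", OF this]
  show ?case using Suc by (simp add: add.assoc)
qed simp

end

theorem theorem5:
  fixes C1 C2 :: "real^3^3" and l1 l2 l3 :: real
    and N :: nat and \<nu> :: "nat \<Rightarrow> real^2" and k :: "nat \<Rightarrow> int"
  assumes "transpose C1 = C1" and "transpose C2 = C2"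
    and "pos_definite (upper_left_block C1)" and "det C1 < 0"
    and "pos_definite (upper_left_block C2)" and "det C2 < 0"
    and "eigenvalues (matrix_inv C1 ** C2) = {l1, l2, l3}"
    and "l1 > l2" and "l2 > l3" and "l3 > 0"
    and "\<And>u. u \<noteq> 0 \<Longrightarrow> u \<bullet> (C2 *v u) = 0 \<Longrightarrow> u \<bullet> (C1 *v u) < 0"
    and "\<And>j. j \<in> {1..N} \<Longrightarrow> \<nu> j $ 2 > 0 \<and> \<nu> j $ 1 + l3 * \<nu> j $ 2 > 0"
  defines "P \<equiv> poncelet_comp C1 C2 \<nu> k N"
    and "r \<equiv> (\<Sum>j=1..N. of_int (k j) * rho l1 l2 l3 (\<nu> j))"
  shows "has_rotation_number (conic_curve C1) P r
     \<and> (r \<in> \<int> \<longrightarrow> (\<forall>z \<in> conic_curve C1. P z = z))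
     \<and> ((\<exists>z \<in> conic_curve C1. P z = z) \<longrightarrow> r \<in> \<int> \<and> (\<forall>z \<in> conic_curve C1. P z = z))"
proof -
  obtain M where "circle_frame M C1 C2 l1 l2 l3"
    using simultaneous_normal_form assms(1-4,7-11) by blast
  then interpret circle_frame M C1 C2 l1 l2 l3 .
  have q: "ccw_param (conic_curve C1) elliptic_param" by (rule ccw_param_elliptic_param)
  have P: "P (elliptic_param t) = elliptic_param (t + r)" for t
    unfolding P_def r_def using assms(12) by (rule poncelet_comp_elliptic_param)
  have rot: "has_rotation_number (conic_curve C1) P r"
    by (rule rotation_number_of_shift[OF q P])
  have S: "conic_curve C1 = range elliptic_param" using q by (simp add: ccw_param_def)
  have "P (elliptic_param t) = elliptic_param t \<longleftrightarrow> r \<in> \<int>" for t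
    by (simp add: P ccw_param_eq_iff[OF q])
  with rot S show ?thesis by auto
qed

end
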